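(* Let $A\in L(X)$ be a bounded complex-linear operator, let $\mathcal E$ be a generating set for the $\mathbb R$-cone $K_{\mathbb R}\subset X_{\mathbb R}$ and $\mathcal M$ a weak-$*$ generating set for the dual cone $K'_{\mathbb R}$. Let $\mathcal T(A)\subset M_2(\mathbb C)$ be the collection of all matrices $$\begin{pmatrix}\langle m_1,Ae_1\rangle & \langle m_2,Ae_1\rangle\\ \langle m_1,Ae_2\rangle & \langle m_2,Ae_2\rangle\end{pmatrix},\qquad e_1,e_2\in\mathcal E,\ m_1,m_2\in\mathcal M ,$$ and suppose that $\mathcal T(A)\subset\overline\Gamma_+$. For $x\in K_{\mathbb C}^*$ and $m_1,m_2\in\mathcal M$ put $$M_{m_1m_2}=M_{m_1m_2}(x)=\begin{pmatrix}\langle m_1,Ax\rangle&\langle m_2,Ax\rangle\\ \langle m_1,x\rangle&\langle m_2,x\rangle\end{pmatrix}.$$ Then the spectral radius of $A$ satisfies $$r_{\rm sp}(A)\ \ge\ \sup_{x\in K_{\mathbb C}^*}\alpha(Ax,x)\ =\ \sup_{x\in K_{\mathbb C}^*}\ \inf_{m_1,m_2\in\mathcal M}\phi(M_{m_1m_2}).$$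
   Context: $X_{\mathbb R}$ is a real Banach space and $X=X_{\mathbb R}\oplus iX_{\mathbb R}$ is a complexification of it (a complex Banach space containing $X_{\mathbb R}$ as a closed real subspace with the restricted norm). $X'_{\mathbb R}$, $X'$ are the topological duals, $\langle\cdot,\cdot\rangle$ the canonical (bilinear) dualities, and real functionals are extended complex-linearly to $X$. An $\mathbb R$-cone $K_{\mathbb R}$ in $X_{\mathbb R}$ is a closed subset with $K_{\mathbb R}+K_{\mathbb R}=K_{\mathbb R}$, $\mathbb R_+K_{\mathbb R}=K_{\mathbb R}$, $K_{\mathbb R}\cap -K_{\mathbb R}=\{0\}$. Its dual cone is $K'_{\mathbb R}=\{\ell\in X'_{\mathbb R}:\langle\ell,x\rangle\ge 0\ \forall x\in K_{\mathbb R}\}$. Its canonical complexification and the complexified dual cone are $$K_{\mathbb C}=\{x\in X:\operatorname{Re}\langle\ell_1,x\rangle\overline{\langle\ell_2,x\rangle}\ge 0\ \ \forall\ell_1,\ell_2\in K'_{\mathbb R}\},\qquad K'_{\mathbb C}=\{\mu\in X':\operatorname{Re}\langle\mu,x_1\rangle\overline{\langle\mu,x_2\rangle}\ge 0\ \ \forall x_1,x_2\in K_{\mathbb R}\}.$$ A superscript $*$ on a cone denotes removal of the zero vector. For a set $S$, $\mathbb R_+(S)$ is the set of finite sums $\sum t_ku_k$, $t_k\ge 0$, $u_k\in S$. A generating set $\mathcal E$ for $K_{\mathbb R}$ is a subset of $K_{\mathbb R}^*$ with $K_{\mathbb R}=\overline{\mathbb R_+(\mathcal E)}$. A weak-$*$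 generating set $\mathcal M$ for $K'_{\mathbb R}$ is a subset of $K'_{\mathbb R}\setminus\{0\}$ such that for every $\mu\in K'_{\mathbb R}$, all $y_1,\dots,y_p\in X$ and $\epsilon>0$ there is $\ell\in\mathbb R_+(\mathcal M)$ with $|\langle\ell,y_k\rangle-\langle\mu,y_k\rangle|<\epsilon$, $k=1,\dots,p$. For $x,y\in K_{\mathbb C}$ write $x\succeq y$ iff $|\langle\mu,x\rangle|\ge|\langle\mu,y\rangle|$ for all $\mu\in K'_{\mathbb C}$, and $\alpha(x,y)=\sup\{t\ge0:x\succeq ty\}$. (In particular $\alpha(0,y)=0$ for $y\in K_{\mathbb C}^*$.) $\overline\Gamma_+$ is the set of $\begin{pmatrix}a&b\\c&d\end{pmatrix}\in M_2(\mathbb C)$ with $|ad-bc|\le\operatorname{Re}(a\bar d+b\bar c)$ and $\operatorname{Re}a\bar b,\operatorname{Re}a\bar c,\operatorname{Re}b\bar d,\operatorname{Re}c\bar d\ge0$. The map $\phi$ with values in $[0,+\infty]$ is defined on complex matrices $M=\begin{pmatrix}a&b\\c&d\end{pmatrix}$ with $\operatorname{Re}a\bar b\ge0$, $\operatorname{Re}c\bar d\ge0$ by: if $\operatorname{rank}M=2$, $\phi(M)=\dfrac{2\operatorname{Re}a\bar b}{|a\bar d+b\bar c|+|ad-bc|}$; if $\operatorname{rank}M=1$, $\phi(M)=|a/c|$ (or $|b/d|$ if $a=c=0$), with the convention $k/0=+\infty$ for $k>0$; if $M=0$, $\phi(M)=+\infty$. (The matrices $M_{m_1m_2}$ satisfy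 the two sign conditions under the hypotheses.) *)

theory Defs
  imports "HOL-Analysis.Analysis"
begin

section \<open>Complex Banach spaces, bounded operators, spectral radius\<close>

class complex_banach = banach +
  fixes scaleC :: "complex \<Rightarrow> 'a \<Rightarrow> 'a"  (infixr \<open>*\<^sub>C\<close> 75)
  assumes scaleC_add_right: "c *\<^sub>C (x + y) = c *\<^sub>C x + c *\<^sub>C y"
    and scaleC_add_left: "(c + d) *\<^sub>C x = c *\<^sub>C x + d *\<^sub>C x"
    and scaleC_scaleC: "c *\<^sub>C (d *\<^sub>C x) = (c * d) *\<^sub>C x"
    and scaleC_of_real: "complex_of_real r *\<^sub>C x = r *\<^sub>R x"
    and norm_scaleC: "norm (c *\<^sub>C x) = cmod c * norm x"

instantiation complex :: complex_banach
begin

definition scaleC_complex :: "complex \<Rightarrow> complex \<Rightarrow> complex" where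
  "scaleC_complex c x = c * x"

instance
  by standard
    (auto simp: scaleC_complex_def algebra_simps norm_mult scaleR_conv_of_real)

end

definition bounded_clinear :: "('a::complex_banach \<Rightarrow> 'b::complex_banach) \<Rightarrow> bool" where
  "bounded_clinear f \<longleftrightarrow> bounded_linear f \<and> (\<forall>c x. f (c *\<^sub>C x) = c *\<^sub>C f x)"

definition spectrum :: "('a::complex_banach \<Rightarrow> 'a) \<Rightarrow> complex set" where
  "spectrum A = {z. \<not> (\<exists>B. bounded_clinear B \<and>
      (\<forall>x. B (z *\<^sub>C x - A x) = x) \<and> (\<forall>x. z *\<^sub>C B x - A (B x) = x))}"

text \<open>The value in \<^typ>\<open>ennreal\<close> makes the supremum meaningful (namely 0) also for the
  zero space, where the spectrum is empty.\<close>

definition spectral_radius :: "('a::complex_banach \<Rightarrow> 'a) \<Rightarrow> ennreal" where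
  "spectral_radius A = (SUP z\<in>spectrum A. ennreal (cmod z))"

section \<open>Complexification of a real Banach space\<close>

text \<open>The inclusion of the real space into the complex one is an isometric embedding
  \<open>\<iota>\<close>; its range is then automatically closed.\<close>

definition complexification :: "('r::banach \<Rightarrow> 'a::complex_banach) \<Rightarrow> bool" where
  "complexification \<iota> \<longleftrightarrow> linear \<iota> \<and> (\<forall>u. norm (\<iota> u) = norm u) \<and>
     (\<forall>x. \<exists>!p. x = \<iota> (fst p) + \<i> *\<^sub>C \<iota> (snd p))"

definition re_im :: "('r::banach \<Rightarrow> 'a::complex_banach) \<Rightarrow> 'a \<Rightarrow> 'r \<times> 'r" where
  "re_im \<iota> x = (THE p. x = \<iota> (fst p) + \<i> *\<^sub>C \<iota> (snd p))"

text \<open>\<open>cpair \<iota> l x\<close> is the pairing of the complex-linear extension of \<open>l\<close> with \<open>x\<close>.\<close>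

definition cpair :: "('r::banach \<Rightarrow> 'a::complex_banach) \<Rightarrow> ('r \<Rightarrow>\<^sub>L real) \<Rightarrow> 'a \<Rightarrow> complex" where
  "cpair \<iota> l x = complex_of_real (blinfun_apply l (fst (re_im \<iota> x)))
     + \<i> * complex_of_real (blinfun_apply l (snd (re_im \<iota> x)))"

section \<open>Cones\<close>

definition real_cone :: "'r::banach set \<Rightarrow> bool" where
  "real_cone K \<longleftrightarrow> closed K \<and> {x + y | x y. x \<in> K \<and> y \<in> K} = K \<and>
     {t *\<^sub>R x | t x. 0 \<le> t \<and> x \<in> K} = K \<and> K \<inter> uminus ` K = {0}"

definition dual_cone :: "'r::banach set \<Rightarrow> ('r \<Rightarrow>\<^sub>L real) set" where
  "dual_cone K = {l. \<forall>x\<in>K. 0 \<le> blinfun_apply l x}"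

definition complex_cone_of :: "('r::banach \<Rightarrow> 'a::complex_banach) \<Rightarrow> 'r set \<Rightarrow> 'a set" where
  "complex_cone_of \<iota> K = {x. \<forall>l1\<in>dual_cone K. \<forall>l2\<in>dual_cone K.
     0 \<le> Re (cpair \<iota> l1 x * cnj (cpair \<iota> l2 x))}"

definition complex_dual_cone_of ::
    "('r::banach \<Rightarrow> 'a::complex_banach) \<Rightarrow> 'r set \<Rightarrow> ('a \<Rightarrow> complex) set" where
  "complex_dual_cone_of \<iota> K = {\<mu>. bounded_clinear \<mu> \<and>
     (\<forall>x1\<in>K. \<forall>x2\<in>K. 0 \<le> Re (\<mu> (\<iota> x1) * cnj (\<mu> (\<iota> x2))))}"

text \<open>The empty sum is included, so that the empty set generates the zero cone.\<close>

definition pos_span :: "'v::real_vector set \<Rightarrow> 'v set" where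
  "pos_span S = {\<Sum>k<n. t k *\<^sub>R u k | (n::nat) t u. \<forall>k<n. 0 \<le> t k \<and> u k \<in> S}"

definition generating :: "'r::banach set \<Rightarrow> 'r set \<Rightarrow> bool" where
  "generating K E \<longleftrightarrow> E \<subseteq> K - {0} \<and> K = closure (pos_span E)"

definition weak_star_generating ::
    "('r::banach \<Rightarrow> 'a::complex_banach) \<Rightarrow> 'r set \<Rightarrow> ('r \<Rightarrow>\<^sub>L real) set \<Rightarrow> bool" where
  "weak_star_generating \<iota> K M \<longleftrightarrow> M \<subseteq> dual_cone K - {0} \<and>
     (\<forall>\<mu>\<in>dual_cone K. \<forall>Y. finite Y \<longrightarrow> (\<forall>\<epsilon>>0. \<exists>l\<in>pos_span M.
        \<forall>y\<in>Y. cmod (cpair \<iota> l y - cpair \<iota> \<mu> y) < \<epsilon>))"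

section \<open>The order on the complex cone\<close>

text \<open>Used only for \<open>x\<close>, \<open>y\<close> in the complexified cone.\<close>

definition dominates ::
    "('r::banach \<Rightarrow> 'a::complex_banach) \<Rightarrow> 'r set \<Rightarrow> 'a \<Rightarrow> 'a \<Rightarrow> bool" where
  "dominates \<iota> K x y \<longleftrightarrow> (\<forall>\<mu>\<in>complex_dual_cone_of \<iota> K. cmod (\<mu> x) \<ge> cmod (\<mu> y))"

definition alpha ::
    "('r::banach \<Rightarrow> 'a::complex_banach) \<Rightarrow> 'r set \<Rightarrow> 'a \<Rightarrow> 'a \<Rightarrow> ennreal" where
  "alpha \<iota> K x y = (SUP t\<in>{t::real. 0 \<le> t \<and> dominates \<iota> K x (t *\<^sub>R y)}. ennreal t)"

section \<open>Two by two matrices\<close>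

definition Gamma_bar :: "(complex^2^2) set" where
  "Gamma_bar = {M. let a = M$1$1; b = M$1$2; c = M$2$1; d = M$2$2 in
     cmod (a * d - b * c) \<le> Re (a * cnj d + b * cnj c) \<and>
     0 \<le> Re (a * cnj b) \<and> 0 \<le> Re (a * cnj c) \<and> 0 \<le> Re (b * cnj d) \<and> 0 \<le> Re (c * cnj d)}"

text \<open>Meaningful when \<open>Re (a * cnj b)\<close> and \<open>Re (c * cnj d)\<close> are nonnegative.  Division in
  \<^typ>\<open>ennreal\<close> satisfies \<open>k / 0 = \<infinity>\<close> for \<open>k > 0\<close>; in rank 1 the quotient \<open>0 / 0\<close> does not
  occur, and in rank 2 the denominator is positive.\<close>

definition phi :: "complex^2^2 \<Rightarrow> ennreal" where
  "phi M = (let a = M$1$1; b = M$1$2; c = M$2$1; d = M$2$2 in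
     if rank M = 2 then
       ennreal (2 * Re (a * cnj b) / (cmod (a * cnj d + b * cnj c) + cmod (a * d - b * c)))
     else if rank M = 1 then
       (if a = 0 \<and> c = 0 then ennreal (cmod b) / ennreal (cmod d)
        else ennreal (cmod a) / ennreal (cmod c))
     else \<infinity>)"

definition pairing_matrix ::
    "('r::banach \<Rightarrow> 'a::complex_banach) \<Rightarrow> ('r \<Rightarrow>\<^sub>L real) \<Rightarrow> ('r \<Rightarrow>\<^sub>L real) \<Rightarrow> 'a \<Rightarrow> 'a
      \<Rightarrow> complex^2^2" where
  "pairing_matrix \<iota> m1 m2 u v =
     vector [vector [cpair \<iota> m1 u, cpair \<iota> m2 u], vector [cpair \<iota> m1 v, cpair \<iota> m2 v]]"

definition test_matrices ::
    "('r::banach \<Rightarrow> 'a::complex_banach) \<Rightarrow> 'r set \<Rightarrow> ('r \<Rightarrow>\<^sub>L real) set \<Rightarrow> ('a \<Rightarrow> 'a)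
      \<Rightarrow> (complex^2^2) set" where
  "test_matrices \<iota> E M A =
     {pairing_matrix \<iota> m1 m2 (A (\<iota> e1)) (A (\<iota> e2)) | e1 e2 m1 m2.
        e1 \<in> E \<and> e2 \<in> E \<and> m1 \<in> M \<and> m2 \<in> M}"

end

theory Submission
  imports Defs "HOL-Complex_Analysis.Complex_Analysis"
begin

text \<open>
  All conditions on two by two matrices in this theory become transparent once they are written as
  \<open>\<bar>g\<bar> \<le> h\<close>, where \<open>g\<close> is complex valued, \<open>h\<close> is real valued and both are real-linear in each
  column of the matrix. Such a condition cuts out a closed convex cone for each column, so it passes
  from generators to everything they generate.

  First use. For a matrix with rows \<open>(a, b)\<close> and \<open>(c, d)\<close>, the inequality
  \<open>\<bar>a d - b c\<bar> \<le> Re (a d* + b c*)\<close>, with \<open>*\<close> for complex conjugation, is of this form in each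
  row and in each column. It therefore extends from \<open>E\<close> and \<open>M\<close> to all of \<open>K\<close> and its dual cone.
  A set of complex numbers with pairwise angles at most a right angle fits into a rotated quadrant;
  hence an element of the complexified cone is a unimodular multiple of \<open>u + i v\<close> with \<open>u\<close> and \<open>v\<close>
  in \<open>K\<close> (here the Hahn-Banach theorem identifies \<open>K\<close> with its bidual), and likewise for the
  complexified dual cone. On such elements the inequality gives at once that \<open>A\<close> preserves the
  complexified cone (\<open>complex_cone_invariant\<close>) and that composition with \<open>A\<close> preserves the
  complexified dual cone (\<open>complex_dual_cone_invariant\<close>).

  Second use. That \<open>y\<close> dominates \<open>t z\<close> on all combinations \<open>s m1 + r m2\<close> with \<open>Re (s r*) \<ge> 0\<close> is
  equivalent, for the matrix of values of \<open>m1, m2\<close> at \<open>y, z\<close>, to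
  \<open>t \<bar>a d - b c\<bar> \<le> Re (a b*) - t\<^sup>2 Re (c d*)\<close> for this pair and for the pairs \<open>(m1, m1)\<close> and
  \<open>(m2, m2)\<close>. This is again a condition \<open>\<bar>g\<bar> \<le> h\<close> in each column, so it only has to be checked on
  \<open>M\<close>; and \<open>phi\<close> is the supremum of the \<open>t\<close> that satisfy it, because in rank two the
  inequality is quadratic in \<open>t\<close> with \<open>phi\<close> as its nonnegative root. Thus \<open>alpha\<close> is the infimum of \<open>phi\<close>
  at each single \<open>x\<close> (\<open>alpha_eq_INF_phi\<close>), and the two suprema agree.

  The spectral bound. If \<open>A x\<close> dominates \<open>t x\<close>, then invariance of the complexified dual cone gives
  \<open>\<bar>l (A\<^sup>n x)\<bar> \<ge> t\<^sup>n \<bar>l x\<bar>\<close> for every \<open>l\<close> in the dual cone, and \<open>l\<close> can be chosen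
  with \<open>l x \<noteq> 0\<close>. Were the spectrum contained in a disc of radius \<open>s < t\<close>, the function
  \<open>w \<mapsto> l ((1 - w A)\<^sup>-\<^sup>1 x)\<close> would be holomorphic for \<open>\<bar>w\<bar> < 1 / s\<close>, and its Taylor coefficients
  \<open>l (A\<^sup>n x)\<close> would be \<open>o(t\<^sup>n)\<close> (\<open>spectral_radius_ge_orbit_growth\<close>).
\<close>

section \<open>Hahn-Banach and separation from a closed cone\<close>

definition sublinear :: "('v::real_vector \<Rightarrow> real) \<Rightarrow> bool" where
  "sublinear p \<longleftrightarrow> (\<forall>x y. p (x + y) \<le> p x + p y) \<and> (\<forall>t\<ge>0. \<forall>x. p (t *\<^sub>R x) = t * p x)"

lemma sublinearI:
  assumes add: "\<And>x y. p (x + y) \<le> p x + p y" and zero: "p 0 = 0"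
    and scale: "\<And>t x. t > 0 \<Longrightarrow> p (t *\<^sub>R x) \<le> t * p x"
  shows "sublinear p"
proof -
  have "p (t *\<^sub>R x) = t * p x" if "t > 0" for t x
  proof (rule antisym)
    have "p ((1 / t) *\<^sub>R (t *\<^sub>R x)) \<le> (1 / t) * p (t *\<^sub>R x)"
      using that by (intro scale) simp
    then show "t * p x \<le> p (t *\<^sub>R x)"
      using that by (simp add: field_simps)
  qed (use scale that in auto)
  then have "p (t *\<^sub>R x) = t * p x" if "t \<ge> 0" for t x
    using that zero by (cases "t = 0") auto
  then show ?thesis
    using add by (auto simp: sublinear_def)
qed

lemma sublinear_add: "sublinear p \<Longrightarrow> p (x + y) \<le> p x + p y"
  and sublinear_scale: "sublinear p \<Longrightarrow> t \<ge> 0 \<Longrightarrow> p (t *\<^sub>R x) = t * p x"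
  by (auto simp: sublinear_def)

lemma sublinear_zero: "sublinear p \<Longrightarrow> p 0 = 0"
  using sublinear_scale[of p 0 0] by simp

lemma sublinear_minus_le: "sublinear p \<Longrightarrow> - p (- x) \<le> p x"
  using sublinear_add[of p x "- x"] sublinear_zero[of p] by simp

text \<open>Subadditivity of the infimum needs the chain: of two members, the smaller one serves at both
  arguments. The common upper bound \<open>p\<close> keeps the infimum finite, since every member is at least
  \<open>- p (- y)\<close> at \<open>y\<close>.\<close>

lemma sublinear_INF_chain:
  assumes "C \<noteq> {}" and sub: "\<And>q. q \<in> C \<Longrightarrow> sublinear q"
    and le: "\<And>q y. q \<in> C \<Longrightarrow> q y \<le> p y"
    and chain: "\<And>q r. q \<in> C \<Longrightarrow> r \<in> C \<Longrightarrow> (\<forall>y. q y \<le> r y) \<or> (\<forall>y. r y \<le> q y)"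
  shows "sublinear (\<lambda>y. INF q\<in>C. q y)" and "\<And>q y. q \<in> C \<Longrightarrow> (INF q\<in>C. q y) \<le> q y"
proof -
  have bdd: "bdd_below ((\<lambda>q. q y) ` C)" for y
  proof (rule bdd_belowI2)
    show "- p (- y) \<le> q y" if "q \<in> C" for q
      using sublinear_minus_le[OF sub[OF that], of y] le[OF that, of "- y"] by simp
  qed
  show low: "(INF q\<in>C. q y) \<le> q y" if "q \<in> C" for q y
    using bdd that by (rule cINF_lower)
  show "sublinear (\<lambda>y. INF q\<in>C. q y)"
  proof (rule sublinearI)
    fix x y
    have *: "(INF q\<in>C. q (x + y)) \<le> q x + r y" if q: "q \<in> C" and r: "r \<in> C" for q r
    proof -
      have "\<exists>s\<in>C. s x \<le> q x \<and> s y \<le> r y"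
        using chain[OF q r] q r by auto
      then obtain s where "s \<in> C" "s x \<le> q x" "s y \<le> r y" by blast
      then show ?thesis
        using low[of s "x + y"] sublinear_add[OF sub, of s x y] by simp
    qed
    have "(INF q\<in>C. q (x + y)) - r y \<le> (INF q\<in>C. q x)" if "r \<in> C" for r
      using *[OF _ that] by (intro cINF_greatest \<open>C \<noteq> {}\<close>) (simp add: algebra_simps)
    then have "(INF q\<in>C. q (x + y)) - (INF q\<in>C. q x) \<le> (INF q\<in>C. q y)"
      by (intro cINF_greatest \<open>C \<noteq> {}\<close>) (simp add: algebra_simps)
    then show "(INF q\<in>C. q (x + y)) \<le> (INF q\<in>C. q x) + (INF q\<in>C. q y)" by simp
  next
    show "(INF q\<in>C. q 0) = 0"
    proof -
      have "(\<lambda>q. q 0) ` C = (\<lambda>q. 0) ` C" using sublinear_zero[OF sub] by (intro image_cong) auto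
      then have "(\<lambda>q. q 0) ` C = {0}" using \<open>C \<noteq> {}\<close> by auto
      then show ?thesis by simp
    qed
  next
    fix t :: real and x assume "t > 0"
    have "(INF q\<in>C. q (t *\<^sub>R x)) / t \<le> (INF q\<in>C. q x)"
    proof (rule cINF_greatest[OF \<open>C \<noteq> {}\<close>])
      fix q assume "q \<in> C"
      then show "(INF q\<in>C. q (t *\<^sub>R x)) / t \<le> q x"
        using low[of q "t *\<^sub>R x"] sublinear_scale[OF sub, of q t x] \<open>t > 0\<close> by (simp add: field_simps)
    qed
    then show "(INF q\<in>C. q (t *\<^sub>R x)) \<le> t * (INF q\<in>C. q x)"
      using \<open>t > 0\<close> by (simp add: field_simps)
  qed
qed

lemma minimal_sublinear_exists:
  fixes p :: "'v::real_vector \<Rightarrow> real"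
  assumes p: "sublinear p"
  obtains q where "sublinear q" "\<And>y. q y \<le> p y"
    "\<And>r. sublinear r \<Longrightarrow> (\<And>y. r y \<le> q y) \<Longrightarrow> r = q"
proof -
  define Q where "Q = {q. sublinear q \<and> (\<forall>y. q y \<le> p y)}"
  define P where "P q r \<longleftrightarrow> (\<forall>y. r y \<le> q y)" for q r :: "'v \<Rightarrow> real"
  have "\<exists>m\<in>Q. \<forall>a\<in>Q. P m a \<longrightarrow> a = m"
  proof (rule predicate_Zorn)
    show "partial_order_on Q (relation_of P Q)"
      by (rule partial_order_on_relation_ofI) (auto simp: P_def fun_eq_iff intro: order_trans order_antisym)
    fix C assume C: "C \<in> Chains (relation_of P Q)"
    show "\<exists>u\<in>Q. \<forall>a\<in>C. P a u"
    proof (cases "C = {}")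
      case True
      then show ?thesis using p by (auto simp: Q_def)
    next
      case False
      have "C \<subseteq> Q" using C by (auto simp: Chains_def relation_of_def)
      then have sub: "\<And>q. q \<in> C \<Longrightarrow> sublinear q" and le: "\<And>q y. q \<in> C \<Longrightarrow> q y \<le> p y"
        by (auto simp: Q_def)
      have chain: "\<And>q r. q \<in> C \<Longrightarrow> r \<in> C \<Longrightarrow> (\<forall>y. q y \<le> r y) \<or> (\<forall>y. r y \<le> q y)"
        using C by (auto simp: Chains_def relation_of_def P_def)
      have inf1: "sublinear (\<lambda>y. INF q\<in>C. q y)"
        by (rule sublinear_INF_chain(1)[of C p]) (fact False sub le chain)+
      have inf2: "\<And>q y. q \<in> C \<Longrightarrow> (INF q\<in>C. q y) \<le> q y"
        by (rule sublinear_INF_chain(2)[of C p]) (use False sub le chain in blast)+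
      obtain q where "q \<in> C" using False by blast
      then have "(INF q\<in>C. q y) \<le> p y" for y
        using inf2[of q y] le[of q y] by simp
      then show ?thesis using inf1 inf2 by (auto simp: Q_def P_def)
    qed
  qed
  then obtain q where q: "q \<in> Q" "\<forall>a\<in>Q. P q a \<longrightarrow> a = q" by blast
  show thesis
  proof (rule that[of q])
    show "sublinear q" "q y \<le> p y" for y using q by (auto simp: Q_def)
    fix r assume "sublinear r" "\<And>y. r y \<le> q y"
    moreover have "r y \<le> p y" for y
      using \<open>r y \<le> q y\<close> q(1) order_trans[of "r y" "q y" "p y"] by (auto simp: Q_def)
    ultimately show "r = q" using q(2) by (auto simp: Q_def P_def)
  qed
qed

text \<open>The reduction of \<open>p\<close> obtained by treating \<open>v\<close> as a direction in which \<open>p\<close> is linear: the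
  sublinear functional stays below \<open>p\<close> and its value at \<open>- v\<close> drops to \<open>- p v\<close> or less.\<close>

definition lower_along :: "'v::real_vector \<Rightarrow> ('v \<Rightarrow> real) \<Rightarrow> 'v \<Rightarrow> real" where
  "lower_along v p y = (INF t\<in>{0..}. p (y + t *\<^sub>R v) - t * p v)"

lemma lower_along_le:
  assumes p: "sublinear p" and t: "t \<ge> 0"
  shows "lower_along v p y \<le> p (y + t *\<^sub>R v) - t * p v"
  unfolding lower_along_def
proof (rule cINF_lower)
  show "bdd_below ((\<lambda>t. p (y + t *\<^sub>R v) - t * p v) ` {0..})"
  proof (rule bdd_belowI2)
    show "- p (- y) \<le> p (y + t *\<^sub>R v) - t * p v" if "t \<in> {0..}" for t
      using sublinear_add[OF p, of "y + t *\<^sub>R v" "- y"] sublinear_scale[OF p, of t v] that by simp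
  qed
qed (use t in auto)

lemma lower_along_greatest:
  assumes "\<And>t. t \<ge> 0 \<Longrightarrow> c \<le> p (y + t *\<^sub>R v) - t * p v"
  shows "c \<le> lower_along v p y"
  unfolding lower_along_def using assms by (intro cINF_greatest) auto

lemma sublinear_lower_along:
  assumes p: "sublinear p"
  shows "sublinear (lower_along v p)"
proof (rule sublinearI)
  fix x y
  have "lower_along v p (x + y) - (p (y + s *\<^sub>R v) - s * p v) \<le> lower_along v p x" if "s \<ge> 0" for s
  proof (rule lower_along_greatest)
    fix t :: real assume "t \<ge> 0"
    have "lower_along v p (x + y) \<le> p ((x + t *\<^sub>R v) + (y + s *\<^sub>R v)) - (t + s) * p v"
      using lower_along_le[OF p, of "t + s" v "x + y"] \<open>t \<ge> 0\<close> that by (simp add: algebra_simps)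
    also have "\<dots> \<le> p (x + t *\<^sub>R v) + p (y + s *\<^sub>R v) - (t + s) * p v"
      using sublinear_add[OF p] by simp
    finally show "lower_along v p (x + y) - (p (y + s *\<^sub>R v) - s * p v) \<le> p (x + t *\<^sub>R v) - t * p v"
      by (simp add: algebra_simps)
  qed
  then have "lower_along v p (x + y) - lower_along v p x \<le> lower_along v p y"
    by (intro lower_along_greatest) (simp add: algebra_simps)
  then show "lower_along v p (x + y) \<le> lower_along v p x + lower_along v p y" by simp
next
  show "lower_along v p 0 = 0"
    using lower_along_le[OF p, of 0 v 0] lower_along_greatest[of 0 p 0 v]
    by (simp add: sublinear_zero[OF p] sublinear_scale[OF p])
next
  fix t :: real and x assume t: "t > 0"
  have "lower_along v p (t *\<^sub>R x) / t \<le> lower_along v p x"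
  proof (rule lower_along_greatest)
    fix s :: real assume "s \<ge> 0"
    then have "lower_along v p (t *\<^sub>R x) \<le> p (t *\<^sub>R (x + s *\<^sub>R v)) - t * s * p v"
      using lower_along_le[OF p, of "t * s" v "t *\<^sub>R x"] t by (simp add: algebra_simps)
    also have "\<dots> = t * (p (x + s *\<^sub>R v) - s * p v)"
      by (subst sublinear_scale[OF p]) (use t in \<open>simp_all add: algebra_simps\<close>)
    finally show "lower_along v p (t *\<^sub>R x) / t \<le> p (x + s *\<^sub>R v) - s * p v"
      using t by (simp add: field_simps)
  qed
  then show "lower_along v p (t *\<^sub>R x) \<le> t * lower_along v p x"
    using t by (simp add: field_simps)
qed

text \<open>A minimal sublinear functional cannot be lowered along any \<open>v\<close>, which says precisely that it is
  superadditive; so it is linear. Taking it below \<open>lower_along x p\<close> rather than below \<open>p\<close> bounds its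
  value at \<open>- x\<close> by \<open>- p x\<close> and thereby makes it touch \<open>p\<close> at \<open>x\<close>.\<close>

theorem Hahn_Banach_sublinear:
  fixes p :: "'v::real_vector \<Rightarrow> real"
  assumes p: "sublinear p"
  obtains f where "linear f" "\<And>y. f y \<le> p y" "f x = p x"
proof -
  obtain f where f: "sublinear f" "\<And>y. f y \<le> lower_along x p y"
      "\<And>r. sublinear r \<Longrightarrow> (\<And>y. r y \<le> f y) \<Longrightarrow> r = f"
    using minimal_sublinear_exists[OF sublinear_lower_along[OF p]] by metis
  have add: "f (y + v) = f y + f v" for y v
  proof (rule antisym)
    have "lower_along v f = f"
      using lower_along_le[OF f(1), of 0 v] by (intro f(3) sublinear_lower_along f(1)) simp
    then show "f y + f v \<le> f (y + v)"
      using lower_along_le[OF f(1), of 1 v y] by simp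
  qed (rule sublinear_add[OF f(1)])
  have neg: "f (- y) = - f y" for y
    using add[of y "- y"] sublinear_zero[OF f(1)] by simp
  have "linear f"
  proof (rule linearI)
    fix t :: real and y
    show "f (t *\<^sub>R y) = t *\<^sub>R f y"
    proof (cases "t \<ge> 0")
      case False
      then show ?thesis
        using sublinear_scale[OF f(1), of "- t" y] neg[of "t *\<^sub>R y"] by simp
    qed (use sublinear_scale[OF f(1)] in simp)
  qed (rule add)
  moreover have le: "f y \<le> p y" for y
    using f(2)[of y] lower_along_le[OF p, of 0 x y] by simp
  moreover have "f x = p x"
    using le[of x] f(2)[of "- x"] neg[of x] lower_along_le[OF p, of 1 x "- x"]
    by (simp add: sublinear_zero[OF p])
  ultimately show thesis by (rule that)
qed

lemma real_cone_add: "real_cone K \<Longrightarrow> x \<in> K \<Longrightarrow> y \<in> K \<Longrightarrow> x + y \<in> K"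
  and real_cone_scale: "real_cone K \<Longrightarrow> x \<in> K \<Longrightarrow> t \<ge> 0 \<Longrightarrow> t *\<^sub>R x \<in> K"
  and real_cone_closed: "real_cone K \<Longrightarrow> closed K"
  and real_cone_zero: "real_cone K \<Longrightarrow> 0 \<in> K"
  and real_cone_pointed: "real_cone K \<Longrightarrow> x \<in> K \<Longrightarrow> - x \<in> K \<Longrightarrow> x = 0"
proof -
  assume K: "real_cone K"
  then have add: "{x + y | x y. x \<in> K \<and> y \<in> K} = K" and scale: "{t *\<^sub>R x | t x. 0 \<le> t \<and> x \<in> K} = K"
    and pt: "K \<inter> uminus ` K = {0}"
    unfolding real_cone_def by auto
  show "closed K" using K unfolding real_cone_def by blast
  show "0 \<in> K" using pt by blast
  show "x + y \<in> K" if "x \<in> K" "y \<in> K" using add that by blast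
  show "t *\<^sub>R x \<in> K" if "x \<in> K" "t \<ge> 0" using scale that by blast
  show "x = 0" if "x \<in> K" "- x \<in> K"
  proof -
    have "x \<in> K \<inter> uminus ` K" using that by (auto intro: image_eqI[of _ _ "- x"])
    then show ?thesis using pt by blast
  qed
qed

text \<open>The distance to \<open>- K\<close> is sublinear, vanishes on \<open>- K\<close> and is positive at \<open>- x\<close>. A linear functional
  below it that agrees with it at \<open>- x\<close> is nonnegative on \<open>K\<close> and negative at \<open>x\<close>; its norm is at
  most one because the distance to \<open>- K\<close> is at most the norm.\<close>

theorem real_cone_separation:
  fixes K :: "'r::banach set"
  assumes K: "real_cone K" and x: "x \<notin> K"
  obtains l where "l \<in> dual_cone K" "blinfun_apply l x < 0"
proof -
  define p where "p y = (INF k\<in>K. norm (y + k))" for y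
  have ne: "K \<noteq> {}" using real_cone_zero[OF K] by blast
  have low: "p y \<le> norm (y + k)" if "k \<in> K" for y k
    unfolding p_def using that by (intro cINF_lower) (auto intro: bdd_belowI2[of _ 0])
  have great: "c \<le> p y" if "\<And>k. k \<in> K \<Longrightarrow> c \<le> norm (y + k)" for c y
    unfolding p_def using that ne by (intro cINF_greatest) auto
  have pos: "0 \<le> p y" for y by (rule great) simp
  have le_norm: "p y \<le> norm y" for y using low[of 0 y] real_cone_zero[OF K] by simp
  have "sublinear p"
  proof (rule sublinearI)
    show "p 0 = 0" using pos[of 0] le_norm[of 0] by simp
    fix y z
    have "p (y + z) - norm (z + k') \<le> p y" if "k' \<in> K" for k'
    proof (rule great)
      fix k assume "k \<in> K"
      then have "p (y + z) \<le> norm ((y + z) + (k + k'))"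
        using that K by (intro low real_cone_add)
      also have "\<dots> \<le> norm (y + k) + norm (z + k')"
        using norm_triangle_ineq[of "y + k" "z + k'"] by (simp add: algebra_simps)
      finally show "p (y + z) - norm (z + k') \<le> norm (y + k)" by simp
    qed
    then have "p (y + z) - p y \<le> p z" by (intro great) (simp add: algebra_simps)
    then show "p (y + z) \<le> p y + p z" by simp
  next
    fix t :: real and y assume t: "t > 0"
    have "p (t *\<^sub>R y) / t \<le> p y"
    proof (rule great)
      fix k assume "k \<in> K"
      then have "p (t *\<^sub>R y) \<le> norm (t *\<^sub>R (y + k))"
        using low[of "t *\<^sub>R k" "t *\<^sub>R y"] real_cone_scale[OF K, of k t] t
        by (simp add: algebra_simps)
      also have "\<dots> = t * norm (y + k)" using t by simp
      finally show "p (t *\<^sub>R y) / t \<le> norm (y + k)" using t by (simp add: field_simps)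
    qed
    then show "p (t *\<^sub>R y) \<le> t * p y" using t by (simp add: field_simps)
  qed
  then obtain f where f: "linear f" "\<And>y. f y \<le> p y" "f (- x) = p (- x)"
    using Hahn_Banach_sublinear[of p "- x"] by blast
  have "\<bar>f y\<bar> \<le> norm y" for y
    using f(2)[of y] f(2)[of "- y"] le_norm[of y] le_norm[of "- y"] linear_neg[OF f(1), of y] by simp
  then have "bounded_linear f"
    using f(1) by (intro bounded_linear_intro[of f 1]) (auto simp: linear_add linear_cmul)
  then have app: "blinfun_apply (Blinfun f) = f" by (rule bounded_linear_Blinfun_apply)
  show thesis
  proof (rule that[of "Blinfun f"])
    show "Blinfun f \<in> dual_cone K"
      unfolding dual_cone_def mem_Collect_eq app
    proof clarify
      fix k assume "k \<in> K"
      then have "p (- k) \<le> 0" using low[of k "- k"] by simp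
      then show "0 \<le> f k" using f(2)[of "- k"] linear_neg[OF f(1), of k] by simp
    qed
    obtain e where e: "e > 0" "\<And>k. k \<in> K \<Longrightarrow> e \<le> dist x k"
    proof -
      have "open (- K)" "x \<in> - K" using real_cone_closed[OF K] x by auto
      then obtain e where "e > 0" "ball x e \<subseteq> - K" by (meson openE)
      then show thesis by (intro that[of e]) (auto simp: subset_iff not_less[symmetric])
    qed
    have "e \<le> p (- x)"
      using e(2) by (intro great) (simp add: dist_norm norm_minus_commute)
    then show "blinfun_apply (Blinfun f) x < 0"
      unfolding app using f(3) e(1) linear_neg[OF f(1), of x] by simp
  qed
qed

section \<open>Continuity of the complexified pairing\<close>

text \<open>The quantitative form of the bounded inverse theorem. By Baire the closure of the image of some ball
  contains a ball, so every \<open>y\<close> is approximated up to half its norm by an image \<open>T x\<close> with \<open>x\<close>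
  controlled by \<open>y\<close>; iterating on the remainder and summing the corrections gives an exact preimage.\<close>

theorem bounded_linear_bij_bounded_below:
  fixes T :: "'b::banach \<Rightarrow> 'c::banach"
  assumes T: "bounded_linear T" and bij: "bij T"
  obtains c where "\<And>x. norm x \<le> c * norm (T x)"
proof -
  interpret T: bounded_linear T by fact
  define C where "C n = closure (T ` cball 0 (real n))" for n
  have cover: "(\<Union>n. C n) = UNIV"
  proof (intro equalityI subset_UNIV subsetI)
    fix y
    obtain x where "y = T x" using bij by (meson bij_pointE)
    moreover obtain n where "norm x \<le> real n" using real_arch_simple by blast
    ultimately have "y \<in> T ` cball 0 (real n)" by auto
    then show "y \<in> (\<Union>n. C n)" 
      using closure_subset[of "T ` cball 0 (real n)"] by (auto simp: C_def)
  qed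
  have "\<exists>n. interior (C n) \<noteq> {}"
  proof (rule ccontr)
    assume "\<not> (\<exists>n. interior (C n) \<noteq> {})"
    then have "euclidean interior_of \<Union>(range C) = {}"
      by (intro Baire_category_alt) (auto simp: completely_metrizable_space_euclidean C_def)
    then show False using cover by simp
  qed
  then obtain n y0 where "y0 \<in> interior (C n)" by blast
  then obtain r where r: "r > 0" "cball y0 r \<subseteq> C n"
    by (meson mem_interior_cball)
  have near: "\<exists>x. norm x \<le> 2 * real n \<and> norm (y - T x) < e" if y: "norm y \<le> r" and "e > 0" for y e
  proof -
    have "y0 + y \<in> C n" "y0 \<in> C n" using r y by (auto simp: dist_norm)
    then obtain u v where u: "norm u \<le> n" "dist (T u) (y0 + y) < e / 2"
      and v: "norm v \<le> n" "dist (T v) y0 < e / 2"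
      using \<open>e > 0\<close> unfolding C_def closure_approachable by (auto dest!: spec[of _ "e / 2"])
    \<comment> \<open>A difference of two approximations recentres the ball at the origin.\<close>
    have "y - T (u - v) = (T v - y0) - (T u - (y0 + y))" by (simp add: T.diff)
    then have "norm (y - T (u - v)) \<le> norm (T v - y0) + norm (T u - (y0 + y))"
      by (simp only: norm_triangle_ineq4)
    then have "norm (y - T (u - v)) < e"
      using u v by (simp add: dist_norm)
    moreover have "norm (u - v) \<le> 2 * real n"
      using norm_triangle_ineq4[of u v] u v by simp
    ultimately show ?thesis by blast
  qed
  define c where "c = 2 * real n / r"
  have c: "c \<ge> 0" using r by (simp add: c_def)
  have half: "\<exists>x. norm x \<le> c * norm y \<and> norm (y - T x) \<le> norm y / 2" for y
  proof (cases "y = 0")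
    case False
    define s where "s = r / norm y"
    have s: "s > 0" using False r by (simp add: s_def)
    have "norm (s *\<^sub>R y) \<le> r" using r False by (simp add: s_def)
    then obtain x where x: "norm x \<le> 2 * real n" "norm (s *\<^sub>R y - T x) < r / 2"
      using near[of "s *\<^sub>R y" "r / 2"] r by auto
    have "y - T ((1 / s) *\<^sub>R x) = (1 / s) *\<^sub>R (s *\<^sub>R y - T x)"
      using s by (simp add: T.scaleR scaleR_diff_right)
    then have "norm (y - T ((1 / s) *\<^sub>R x)) = norm (s *\<^sub>R y - T x) / s"
      using s by simp
    also have "\<dots> \<le> norm y / 2"
      using x(2) s False r by (simp add: s_def field_simps)
    finally have "norm (y - T ((1 / s) *\<^sub>R x)) \<le> norm y / 2" .
    moreover have "norm ((1 / s) *\<^sub>R x) \<le> c * norm y"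
      using x(1) s False r by (simp add: s_def c_def field_simps)
    ultimately show ?thesis by blast
  qed (auto intro: exI[of _ 0])
  then obtain g where g: "\<And>y. norm (g y) \<le> c * norm y" "\<And>y. norm (y - T (g y)) \<le> norm y / 2"
    by metis
  have main: "norm x \<le> (2 * c) * norm (T x)" for x
  proof -
    \<comment> \<open>The remainder after \<open>k\<close> corrections.\<close>
    define res where "res = rec_nat (T x) (\<lambda>_ y. y - T (g y))"
    have res0: "res 0 = T x" and resS: "res (Suc k) = res k - T (g (res k))" for k
      by (simp_all add: res_def)
    have nres: "norm (res k) \<le> norm (T x) * (1/2) ^ k" for k
    proof (induction k)
      case (Suc k)
      then show ?case using g(2)[of "res k"] by (simp add: resS)
    qed (simp add: res0)
    have bound: "norm (g (res k)) \<le> (c * norm (T x)) * (1/2) ^ k" for k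
      using g(1)[of "res k"] mult_left_mono[OF nres c, of k] by (simp add: mult.assoc)
    have geo: "(\<lambda>k. (c * norm (T x)) * (1/2) ^ k) sums ((c * norm (T x)) * 2)"
      using geometric_sums[of "1/2 :: real"] by (intro sums_mult) simp
    have sumn: "summable (\<lambda>k. norm (g (res k)))"
      by (rule summable_comparison_test'[OF sums_summable[OF geo], of 0]) (use bound in simp)
    then have sums: "(\<lambda>k. g (res k)) sums (\<Sum>k. g (res k))"
      by (rule summable_sums[OF summable_norm_cancel])
    have part: "(\<Sum>k<m. T (g (res k))) = T x - res m" for m
      by (induction m) (simp_all add: res0 resS)
    have "res \<longlonglongrightarrow> 0"
    proof (rule Lim_null_comparison)
      show "\<forall>\<^sub>F k in sequentially. norm (res k) \<le> norm (T x) * (1/2) ^ k" using nres by simp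
      show "(\<lambda>k. norm (T x) * (1/2) ^ k) \<longlonglongrightarrow> 0"
        by (intro tendsto_mult_right_zero LIMSEQ_power_zero) simp
    qed
    then have "(\<lambda>m. T x - res m) \<longlonglongrightarrow> T x - 0" by (intro tendsto_diff tendsto_const)
    then have "(\<lambda>k. T (g (res k))) sums T x" unfolding sums_def part by simp
    then have "T (\<Sum>k. g (res k)) = T x"
      using T.sums[OF sums] sums_unique2 by blast
    then have "x = (\<Sum>k. g (res k))" using bij by (auto dest: bij_is_inj injD)
    moreover have "norm (\<Sum>k. g (res k)) \<le> (\<Sum>k. norm (g (res k)))"
      using sumn by (rule summable_norm)
    moreover have "\<dots> \<le> (\<Sum>k. (c * norm (T x)) * (1/2) ^ k)"
      using bound sumn sums_summable[OF geo] by (intro suminf_le) auto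
    ultimately show ?thesis using sums_unique[OF geo] by simp
  qed
  show thesis by (rule that[OF main])
qed

lemma scaleC_zero_left [simp]: "0 *\<^sub>C x = 0"
  and scaleC_zero_right [simp]: "c *\<^sub>C 0 = (0 :: 'a)"
  and scaleC_one [simp]: "1 *\<^sub>C x = x"
  and scaleC_minus_left: "(- c) *\<^sub>C x = - (c *\<^sub>C x)"
  and scaleC_diff_left: "(c - d) *\<^sub>C x = c *\<^sub>C x - d *\<^sub>C x"
  and scaleC_diff_right: "c *\<^sub>C (x - y) = c *\<^sub>C x - c *\<^sub>C y"
  for x y :: "'a::complex_banach"
proof -
  show zl: "0 *\<^sub>C x = 0" for x :: 'a using scaleC_of_real[of 0 x] by simp
  show zr: "c *\<^sub>C 0 = (0 :: 'a)" using norm_scaleC[of c "0 :: 'a"] by simp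
  show "1 *\<^sub>C x = x" using scaleC_of_real[of 1 x] by simp
  show ml: "(- c) *\<^sub>C x = - (c *\<^sub>C x)" for c and x :: 'a
    using scaleC_add_left[of c "- c" x] zl by (simp add: minus_unique)
  have mr: "c *\<^sub>C (- x) = - (c *\<^sub>C x)" for x :: 'a
    using scaleC_add_right[of c x "- x"] zr by (simp add: minus_unique)
  show "(c - d) *\<^sub>C x = c *\<^sub>C x - d *\<^sub>C x"
    using scaleC_add_left[of c "- d" x] ml by simp
  show "c *\<^sub>C (x - y) = c *\<^sub>C x - c *\<^sub>C y"
    using scaleC_add_right[of c x "- y"] mr by simp
qed

lemma scaleC_scaleR: "c *\<^sub>C (r *\<^sub>R (x :: 'a::complex_banach)) = r *\<^sub>R (c *\<^sub>C x)"
  by (simp add: scaleC_of_real[symmetric] scaleC_scaleC mult.commute)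

lemma bounded_linear_scaleC: "bounded_linear (\<lambda>x. c *\<^sub>C (x :: 'a::complex_banach))"
  by (rule bounded_linear_intro[of _ "cmod c"])
    (simp_all add: scaleC_add_right scaleC_scaleR norm_scaleC mult.commute)

lemma bounded_clinear_add: "bounded_clinear f \<Longrightarrow> f (x + y) = f x + f y"
  and bounded_clinear_diff: "bounded_clinear f \<Longrightarrow> f (x - y) = f x - f y"
  and bounded_clinear_scaleC: "bounded_clinear f \<Longrightarrow> f (c *\<^sub>C x) = c *\<^sub>C f x"
  and bounded_clinear_scaleR: "bounded_clinear f \<Longrightarrow> f (r *\<^sub>R x) = r *\<^sub>R f x"
  and bounded_clinear_imp_bounded_linear: "bounded_clinear f \<Longrightarrow> bounded_linear f"
  by (simp_all add: bounded_clinear_def linear_simps)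

lemma bounded_clinear_compose:
  "bounded_clinear f \<Longrightarrow> bounded_clinear g \<Longrightarrow> bounded_clinear (\<lambda>x. f (g x))"
  by (simp add: bounded_clinear_def bounded_linear_compose)

lemma bounded_clinear_functional_scaleC:
  "bounded_clinear (\<mu> :: 'a::complex_banach \<Rightarrow> complex) \<Longrightarrow> \<mu> (c *\<^sub>C x) = c * \<mu> x"
  by (simp add: bounded_clinear_scaleC scaleC_complex_def)

context
  fixes \<iota> :: "'r::banach \<Rightarrow> 'a::complex_banach"
  assumes cx: "complexification \<iota>"
begin

lemma complexification_bounded_linear: "bounded_linear \<iota>"
  using cx by (intro bounded_linear_intro[of _ 1]) (auto simp: complexification_def linear_add linear_scale)

interpretation \<iota>: bounded_linear \<iota> by (rule complexification_bounded_linear)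

lemma re_im_ex1: "\<exists>!p. x = \<iota> (fst p) + \<i> *\<^sub>C \<iota> (snd p)"
  using cx by (auto simp: complexification_def)

lemma re_im_decomp: "x = \<iota> (fst (re_im \<iota> x)) + \<i> *\<^sub>C \<iota> (snd (re_im \<iota> x))"
  unfolding re_im_def by (rule theI') (rule re_im_ex1)

lemma re_im_eqI: "x = \<iota> u + \<i> *\<^sub>C \<iota> v \<Longrightarrow> re_im \<iota> x = (u, v)"
  using re_im_ex1[of x] re_im_decomp[of x] by (metis fst_conv snd_conv)

lemma cpair_decomp: "x = \<iota> u + \<i> *\<^sub>C \<iota> v \<Longrightarrow> cpair \<iota> l x = Complex (blinfun_apply l u) (blinfun_apply l v)"
  using re_im_eqI[of x u v] by (simp add: cpair_def complex_eq_iff)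

lemma cpair_embed: "cpair \<iota> l (\<iota> u) = complex_of_real (blinfun_apply l u)"
  using cpair_decomp[of "\<iota> u" u 0 l] by (simp add: complex_of_real_def \<iota>.zero blinfun.zero_right)

text \<open>\<open>complexification\<close> asks only for an algebraic direct sum. That the two real projections are
  continuous comes from completeness, through the bijection \<open>(u, v) \<mapsto> u + i v\<close>.\<close>

lemma re_im_bound: obtains c where "\<And>x. norm (re_im \<iota> x) \<le> c * norm x"
proof -
  define T where "T = (\<lambda>p. \<iota> (fst p) + \<i> *\<^sub>C \<iota> (snd p))"
  have T: "bounded_linear T"
    unfolding T_def
    by (intro bounded_linear_add bounded_linear_compose[OF complexification_bounded_linear]
        bounded_linear_compose[OF bounded_linear_scaleC] bounded_linear_fst bounded_linear_snd)
  have "bij T"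
    unfolding T_def bij_iff using re_im_ex1 by metis
  from bounded_linear_bij_bounded_below[OF T this] obtain c where c: "\<And>p. norm p \<le> c * norm (T p)"
    by blast
  have "norm (re_im \<iota> x) \<le> c * norm x" for x
    using c[of "re_im \<iota> x"] re_im_decomp[of x] by (simp add: T_def)
  then show thesis by (rule that)
qed

lemma cpair_bounded_clinear: "bounded_clinear (cpair \<iota> l)"
proof -
  obtain c where c: "\<And>x. norm (re_im \<iota> x) \<le> c * norm x"
    using re_im_bound by metis
  have add: "cpair \<iota> l (x + y) = cpair \<iota> l x + cpair \<iota> l y" for x y
  proof -
    have "x + y = \<iota> (fst (re_im \<iota> x) + fst (re_im \<iota> y)) + \<i> *\<^sub>C \<iota> (snd (re_im \<iota> x) + snd (re_im \<iota> y))"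
      by (subst (1) re_im_decomp[of x], subst (1) re_im_decomp[of y])
        (simp only: \<iota>.add scaleC_add_right add.assoc add.left_commute)
    from cpair_decomp[OF this, of l] show ?thesis
      by (simp add: cpair_def complex_eq_iff blinfun.add_right)
  qed
  have scale: "cpair \<iota> l (k *\<^sub>C x) = k * cpair \<iota> l x" for k x
  proof -
    define u v where "u = fst (re_im \<iota> x)" and "v = snd (re_im \<iota> x)"
    have x: "x = \<iota> u + \<i> *\<^sub>C \<iota> v" unfolding u_def v_def by (rule re_im_decomp)
    have i: "\<i> *\<^sub>C \<i> *\<^sub>C z = - z" for z :: 'a
      by (simp add: scaleC_scaleC scaleC_minus_left)
    have "k *\<^sub>C z = Re k *\<^sub>R z + Im k *\<^sub>R (\<i> *\<^sub>C z)" for z :: 'a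
    proof -
      have "k *\<^sub>C z = (of_real (Re k) + of_real (Im k) * \<i>) *\<^sub>C z"
        using complex_eq[of k] by (simp add: mult.commute)
      then show ?thesis by (simp only: scaleC_add_left scaleC_scaleC[symmetric] scaleC_of_real)
    qed
    then have "k *\<^sub>C x = Re k *\<^sub>R (\<iota> u + \<i> *\<^sub>C \<iota> v) + Im k *\<^sub>R (\<i> *\<^sub>C (\<iota> u + \<i> *\<^sub>C \<iota> v))"
      using x by simp
    also have "\<dots> = \<iota> (Re k *\<^sub>R u - Im k *\<^sub>R v) + \<i> *\<^sub>C \<iota> (Im k *\<^sub>R u + Re k *\<^sub>R v)"
      by (simp add: i scaleC_add_right scaleC_scaleR scaleR_add_right scaleR_diff_right \<iota>.add \<iota>.diff \<iota>.scaleR)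
    finally have "k *\<^sub>C x = \<iota> (Re k *\<^sub>R u - Im k *\<^sub>R v) + \<i> *\<^sub>C \<iota> (Im k *\<^sub>R u + Re k *\<^sub>R v)" .
    from cpair_decomp[OF this, of l] cpair_decomp[OF x, of l] show ?thesis
      by (simp add: complex_eq_iff blinfun.add_right blinfun.diff_right blinfun.scaleR_right)
  qed
  have "bounded_linear (cpair \<iota> l)"
  proof (rule bounded_linear_intro)
    show "cpair \<iota> l (r *\<^sub>R x) = r *\<^sub>R cpair \<iota> l x" for r x
      using scale[of "of_real r" x] by (simp add: scaleC_of_real scaleR_conv_of_real)
    fix x
    have "norm (cpair \<iota> l x) \<le> \<bar>blinfun_apply l (fst (re_im \<iota> x))\<bar> + \<bar>blinfun_apply l (snd (re_im \<iota> x))\<bar>"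
      unfolding cpair_def by (rule norm_triangle_le) (simp add: norm_mult)
    also have "\<dots> \<le> norm l * norm (fst (re_im \<iota> x)) + norm l * norm (snd (re_im \<iota> x))"
      using norm_blinfun[of l "fst (re_im \<iota> x)"] norm_blinfun[of l "snd (re_im \<iota> x)"] by simp
    also have "\<dots> \<le> norm l * (c * norm x) + norm l * (c * norm x)"
      using norm_fst_le[of "fst (re_im \<iota> x)" "snd (re_im \<iota> x)"]
        norm_snd_le[of "snd (re_im \<iota> x)" "fst (re_im \<iota> x)"] c[of x]
      by (intro add_mono mult_left_mono) auto
    finally show "norm (cpair \<iota> l x) \<le> norm x * (2 * norm l * c)" by (simp add: mult_ac)
  qed (rule add)
  then show ?thesis using scale by (simp add: bounded_clinear_def scaleC_complex_def)
qed

end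

section \<open>Orbit growth and the spectral radius\<close>

text \<open>The resolvent identity \<open>S w - S w0 = (w - w0) S w0 A (S w)\<close>, for \<open>S w = (1 - w A)\<^sup>-\<^sup>1\<close>, first bounds
  \<open>S w x\<close> near \<open>w0\<close>, then shows that it is continuous there, and finally identifies the derivative.\<close>

lemma resolvent_functional_holomorphic:
  fixes A :: "'a::complex_banach \<Rightarrow> 'a" and S :: "complex \<Rightarrow> 'a \<Rightarrow> 'a"
  assumes A: "bounded_clinear A" and \<mu>: "bounded_clinear (\<mu> :: 'a \<Rightarrow> complex)" and "open U"
    and S: "\<And>w. w \<in> U \<Longrightarrow> bounded_clinear (S w)"
    and Sl: "\<And>w y. w \<in> U \<Longrightarrow> S w (y - w *\<^sub>C A y) = y"
    and Sr: "\<And>w y. w \<in> U \<Longrightarrow> S w y - w *\<^sub>C A (S w y) = y"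
  shows "(\<lambda>w. \<mu> (S w x)) holomorphic_on U"
proof (rule holomorphic_onI)
  fix w0 assume w0: "w0 \<in> U"
  have res: "S w x - S w0 x = (w - w0) *\<^sub>C S w0 (A (S w x))" if "w \<in> U" for w
  proof -
    define d where "d = S w x - S w0 x"
    have "d - w0 *\<^sub>C A d = (S w x - w *\<^sub>C A (S w x)) - (S w0 x - w0 *\<^sub>C A (S w0 x)) + (w - w0) *\<^sub>C A (S w x)"
      by (simp add: d_def bounded_clinear_diff[OF A] scaleC_diff_left scaleC_diff_right)
    also have "\<dots> = (w - w0) *\<^sub>C A (S w x)"
      using Sr[OF that, of x] Sr[OF w0, of x] by simp
    finally show ?thesis
      using Sl[OF w0, of d] by (simp add: d_def bounded_clinear_scaleC[OF S[OF w0]])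
  qed
  have SA: "bounded_clinear (\<lambda>v. S w0 (A v))" by (rule bounded_clinear_compose[OF S[OF w0] A])
  obtain k where k: "k \<ge> 0" "\<And>v. norm (S w0 (A v)) \<le> norm v * k"
    using bounded_linear.nonneg_bounded[OF bounded_clinear_imp_bounded_linear[OF SA]] by blast
  \<comment> \<open>This close to \<open>w0\<close>, the identity can be solved for the norm of \<open>S w x\<close>.\<close>
  define near where "near = (\<lambda>w. w \<in> U \<and> cmod (w - w0) * k \<le> 1 / 2)"
  have ev: "eventually near (at w0 within U)"
  proof -
    have "((\<lambda>w. cmod (w - w0) * k) \<longlongrightarrow> cmod (w0 - w0) * k) (at w0 within U)"
      by (intro tendsto_intros)
    then have "eventually (\<lambda>w. cmod (w - w0) * k < 1 / 2) (at w0 within U)"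
      by (rule order_tendstoD) simp
    then show ?thesis
      by (rule eventually_mp[rotated]) (auto simp: near_def eventually_at_filter intro: always_eventually)
  qed
  have bound: "norm (S w x - S w0 x) \<le> cmod (w - w0) * (2 * norm (S w0 x) * k)" if "near w" for w
  proof -
    have w: "w \<in> U" "cmod (w - w0) * k \<le> 1 / 2" using that by (auto simp: near_def)
    have 1: "norm (S w x - S w0 x) \<le> cmod (w - w0) * (norm (S w x) * k)"
      using k(2)[of "S w x"] by (simp add: res[OF w(1)] norm_scaleC mult_left_mono)
    have "norm (S w x) \<le> norm (S w0 x) + norm (S w x - S w0 x)"
      using norm_triangle_ineq[of "S w0 x" "S w x - S w0 x"] by simp
    also have "\<dots> \<le> norm (S w0 x) + (cmod (w - w0) * k) * norm (S w x)"
      using 1 by (simp add: mult_ac)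
    also have "\<dots> \<le> norm (S w0 x) + (1 / 2) * norm (S w x)"
      using w(2) by (intro add_left_mono mult_right_mono) auto
    finally have "norm (S w x) \<le> 2 * norm (S w0 x)" by simp
    then have "cmod (w - w0) * (norm (S w x) * k) \<le> cmod (w - w0) * (2 * norm (S w0 x) * k)"
      using k(1) by (intro mult_left_mono mult_right_mono) auto
    with 1 show ?thesis by linarith
  qed
  have "((\<lambda>w. S w x - S w0 x) \<longlongrightarrow> 0) (at w0 within U)"
  proof (rule Lim_null_comparison)
    show "eventually (\<lambda>w. norm (S w x - S w0 x) \<le> cmod (w - w0) * (2 * norm (S w0 x) * k)) (at w0 within U)"
      using ev by eventually_elim (rule bound)
    have "((\<lambda>w. cmod (w - w0) * (2 * norm (S w0 x) * k)) \<longlongrightarrow> cmod (w0 - w0) * (2 * norm (S w0 x) * k)) (at w0 within U)"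
      by (intro tendsto_intros)
    then show "((\<lambda>w. cmod (w - w0) * (2 * norm (S w0 x) * k)) \<longlongrightarrow> 0) (at w0 within U)" by simp
  qed
  then have cont: "((\<lambda>w. S w x) \<longlongrightarrow> S w0 x) (at w0 within U)" by (simp add: LIM_zero_iff)
  have \<mu>SA: "bounded_clinear (\<lambda>v. \<mu> (S w0 (A v)))" by (rule bounded_clinear_compose[OF \<mu> SA])
  have "((\<lambda>w. \<mu> (S w0 (A (S w x)))) \<longlongrightarrow> \<mu> (S w0 (A (S w0 x)))) (at w0 within U)"
    by (rule bounded_linear.tendsto[OF bounded_clinear_imp_bounded_linear[OF \<mu>SA] cont])
  moreover have "eventually (\<lambda>w. \<mu> (S w0 (A (S w x))) = (\<mu> (S w x) - \<mu> (S w0 x)) / (w - w0)) (at w0 within U)"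
    unfolding eventually_at_filter
  proof (intro always_eventually allI impI)
    fix w assume "w \<noteq> w0" "w \<in> U"
    have "\<mu> (S w x) - \<mu> (S w0 x) = (w - w0) * \<mu> (S w0 (A (S w x)))"
      by (simp add: bounded_clinear_diff[OF \<mu>, symmetric] res \<open>w \<in> U\<close> bounded_clinear_functional_scaleC[OF \<mu>])
    then show "\<mu> (S w0 (A (S w x))) = (\<mu> (S w x) - \<mu> (S w0 x)) / (w - w0)"
      using \<open>w \<noteq> w0\<close> by simp
  qed
  ultimately have "((\<lambda>w. (\<mu> (S w x) - \<mu> (S w0 x)) / (w - w0)) \<longlongrightarrow> \<mu> (S w0 (A (S w0 x)))) (at w0 within U)"
    by (rule Lim_transform_eventually)
  then show "(\<lambda>w. \<mu> (S w x)) field_differentiable at w0 within U"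
    unfolding field_differentiable_def has_field_derivative_iff by blast
qed

text \<open>In the variable \<open>w = 1 / z\<close> the resolvent at infinity becomes regular at \<open>w = 0\<close>: the Neumann
  expansion there identifies \<open>\<mu> (A\<^sup>n x)\<close> as Taylor coefficients, and holomorphy on the disc of radius
  \<open>1 / s\<close> forces convergence of the series at \<open>1 / t\<close>, against the lower bound on its terms.\<close>

theorem spectral_radius_ge_orbit_growth:
  fixes A :: "'a::complex_banach \<Rightarrow> 'a" and \<mu> :: "'a \<Rightarrow> complex"
  assumes A: "bounded_clinear A" and \<mu>: "bounded_clinear \<mu>" and t: "t > 0" and c: "c > 0"
    and growth: "\<And>n. c * t ^ n \<le> cmod (\<mu> ((A ^^ n) x))"
  shows "ennreal t \<le> spectral_radius A"
proof (rule ccontr)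
  assume "\<not> ennreal t \<le> spectral_radius A"
  then obtain r where r: "spectral_radius A < r" "r < ennreal t"
    using dense[of "spectral_radius A" "ennreal t"] by (auto simp: not_le)
  obtain s where rs: "r = ennreal s" "s \<ge> 0"
    using r(2) by (cases r) auto
  have s: "0 < s" "s < t" "spectral_radius A < ennreal s"
    using r le_less_trans[OF zero_le r(1)] rs(2) by (auto simp: rs(1) ennreal_less_iff)
  have res: "z \<notin> spectrum A" if "cmod z \<ge> s" for z
  proof
    assume "z \<in> spectrum A"
    then have "ennreal (cmod z) \<le> spectral_radius A"
      unfolding spectral_radius_def by (rule SUP_upper)
    also have "\<dots> < ennreal s" by (rule s(3))
    finally show False using that s(1) by (simp add: ennreal_less_iff)
  qed
  define U where "U = ball (0 :: complex) (1 / s)"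
  have "\<exists>T. bounded_clinear T \<and> (\<forall>y. T (y - w *\<^sub>C A y) = y) \<and> (\<forall>y. T y - w *\<^sub>C A (T y) = y)"
    if w: "w \<in> U" for w
  proof (cases "w = 0")
    case True
    have "bounded_clinear (\<lambda>y :: 'a. y)" by (simp add: bounded_clinear_def)
    then show ?thesis using True by (intro exI[of _ "\<lambda>y. y"]) simp
  next
    case False
    have "cmod (1 / w) \<ge> s" using w False s(1) by (simp add: U_def norm_divide field_simps)
    then obtain B where B: "bounded_clinear B" "\<And>y. B ((1 / w) *\<^sub>C y - A y) = y"
        "\<And>y. (1 / w) *\<^sub>C B y - A (B y) = y"
      using res[of "1 / w"] unfolding spectrum_def by auto
    \<comment> \<open>\<open>(1 - w A)\<^sup>-\<^sup>1 = (1 / w) (1 / w - A)\<^sup>-\<^sup>1\<close>.\<close>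
    let ?T = "\<lambda>y. B ((1 / w) *\<^sub>C y)"
    have "bounded_clinear (\<lambda>y :: 'a. (1 / w) *\<^sub>C y)"
      by (simp add: bounded_clinear_def bounded_linear_scaleC scaleC_scaleC mult.commute)
    then have "bounded_clinear ?T" by (rule bounded_clinear_compose[OF B(1)])
    moreover have "?T (y - w *\<^sub>C A y) = y" for y
      using False B(2)[of y] by (simp add: scaleC_diff_right scaleC_scaleC)
    moreover have "?T y - w *\<^sub>C A (?T y) = y" for y
    proof -
      have "w *\<^sub>C ((1 / w) *\<^sub>C ?T y - A (?T y)) = w *\<^sub>C (1 / w) *\<^sub>C y" by (simp only: B(3))
      then show ?thesis using False by (simp add: scaleC_diff_right scaleC_scaleC)
    qed
    ultimately show ?thesis by blast
  qed
  then have "\<exists>S. \<forall>w\<in>U. bounded_clinear (S w) \<and> (\<forall>y. S w (y - w *\<^sub>C A y) = y) \<and> (\<forall>y. S w y - w *\<^sub>C A (S w y) = y)"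
    by (intro bchoice) blast
  then obtain S where S: "\<And>w. w \<in> U \<Longrightarrow> bounded_clinear (S w)"
      "\<And>w y. w \<in> U \<Longrightarrow> S w (y - w *\<^sub>C A y) = y" "\<And>w y. w \<in> U \<Longrightarrow> S w y - w *\<^sub>C A (S w y) = y"
    by blast
  define h where "h w = \<mu> (S w x)" for w
  define F where "F = Abs_fps (\<lambda>n. \<mu> ((A ^^ n) x))"
  have hol: "h holomorphic_on eball 0 (ereal (1 / s))"
    using resolvent_functional_holomorphic[OF A \<mu> _ S, where x = x and U = U] by (simp add: U_def h_def[abs_def])
  obtain K where K: "K > 0" "\<And>v. norm (A v) \<le> norm v * K"
    using bounded_linear.pos_bounded[OF bounded_clinear_imp_bounded_linear[OF A]] by blast
  obtain L where L: "L > 0" "\<And>v. norm (\<mu> v) \<le> norm v * L"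
    using bounded_linear.pos_bounded[OF bounded_clinear_imp_bounded_linear[OF \<mu>]] by blast
  \<comment> \<open>Within radius \<open>1 / (2 K)\<close> the remainder of the Neumann expansion decays geometrically.\<close>
  define \<delta> where "\<delta> = min (1 / s) (1 / (2 * K))"
  have \<delta>: "\<delta> > 0" using s K by (simp add: \<delta>_def)
  have Apow: "norm ((A ^^ n) v) \<le> K ^ n * norm v" for n v
  proof (induction n)
    case (Suc n)
    have "norm ((A ^^ Suc n) v) \<le> norm ((A ^^ n) v) * K" using K(2) by simp
    also have "\<dots> \<le> K ^ n * norm v * K" using Suc K(1) by (intro mult_right_mono) auto
    finally show ?case by (simp add: mult_ac)
  qed simp
  have Apow_add: "(A ^^ n) (u + v) = (A ^^ n) u + (A ^^ n) v" and
    Apow_scale: "(A ^^ n) (k *\<^sub>C v) = k *\<^sub>C (A ^^ n) v" for n u v k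
    by (induction n) (simp_all add: bounded_clinear_add[OF A] bounded_clinear_scaleC[OF A])
  have sums: "(\<lambda>n. fps_nth F n * w ^ n) sums h w" if w: "cmod w < \<delta>" for w
  proof -
    have wU: "w \<in> U" using w by (simp add: U_def \<delta>_def)
    have wK: "cmod w * K \<le> 1 / 2" using w K(1) by (simp add: \<delta>_def field_simps)
    define y where "y = S w x"
    have y: "y = x + w *\<^sub>C A y" using S(3)[OF wU, of x] by (simp add: y_def algebra_simps)
    have part: "(\<Sum>k<n. fps_nth F k * w ^ k) = h w - w ^ n * \<mu> ((A ^^ n) y)" for n
    proof (induction n)
      case (Suc n)
      have "(A ^^ n) y = (A ^^ n) (x + w *\<^sub>C A y)" using y by (rule arg_cong)
      also have "\<dots> = (A ^^ n) x + w *\<^sub>C (A ^^ Suc n) y"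
        by (simp add: Apow_add Apow_scale funpow_swap1)
      finally have "\<mu> ((A ^^ n) y) = \<mu> ((A ^^ n) x) + w * \<mu> ((A ^^ Suc n) y)"
        by (simp only: bounded_clinear_add[OF \<mu>] bounded_clinear_functional_scaleC[OF \<mu>])
      then show ?case using Suc by (simp add: F_def algebra_simps)
    qed (simp add: h_def y_def)
    have "(\<lambda>n. w ^ n * \<mu> ((A ^^ n) y)) \<longlonglongrightarrow> 0"
    proof (rule Lim_null_comparison)
      have "norm (w ^ n * \<mu> ((A ^^ n) y)) \<le> (1 / 2) ^ n * (norm y * L)" for n
      proof -
        have "norm (\<mu> ((A ^^ n) y)) \<le> norm ((A ^^ n) y) * L" by (rule L(2))
        also have "\<dots> \<le> K ^ n * norm y * L" using Apow L(1) by (intro mult_right_mono) auto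
        finally have "norm (w ^ n * \<mu> ((A ^^ n) y)) \<le> cmod w ^ n * (K ^ n * norm y * L)"
          by (simp add: norm_mult norm_power mult_left_mono)
        also have "\<dots> = (cmod w * K) ^ n * (norm y * L)" by (simp add: power_mult_distrib mult_ac)
        also have "\<dots> \<le> (1 / 2) ^ n * (norm y * L)"
          using wK K(1) L(1) by (intro mult_right_mono power_mono) auto
        finally show ?thesis .
      qed
      then show "\<forall>\<^sub>F n in sequentially. norm (w ^ n * \<mu> ((A ^^ n) y)) \<le> (1 / 2) ^ n * (norm y * L)"
        by simp
      show "(\<lambda>n. (1 / 2) ^ n * (norm y * L)) \<longlonglongrightarrow> 0"
        by (intro tendsto_mult_left_zero LIMSEQ_power_zero) simp
    qed
    then have "(\<lambda>n. h w - w ^ n * \<mu> ((A ^^ n) y)) \<longlonglongrightarrow> h w - 0" by (intro tendsto_intros)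
    then show ?thesis unfolding sums_def part by simp
  qed
  have exp: "h has_fps_expansion F"
    unfolding has_fps_expansion_def
  proof
    have "ereal (cmod (complex_of_real (\<delta> / 2))) \<le> conv_radius (fps_nth F)"
      using \<delta> by (intro conv_radius_geI sums_summable[OF sums]) simp
    then show "fps_conv_radius F > 0"
      using \<delta> unfolding fps_conv_radius_def by (auto intro: less_le_trans[rotated])
    have "eventually (\<lambda>z. z \<in> ball 0 \<delta>) (nhds (0 :: complex))"
      using \<delta> by (intro eventually_nhds_in_open) auto
    then show "\<forall>\<^sub>F z in nhds 0. eval_fps F z = h z"
      by eventually_elim (simp add: eval_fps_def sums_unique[OF sums, symmetric])
  qed
  have "(\<lambda>n. fps_nth F n * complex_of_real (1 / t) ^ n) sums h (complex_of_real (1 / t))"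
    using s t by (intro has_fps_expansion_imp_sums_complex[OF exp hol]) (simp add: field_simps norm_divide)
  then have "(\<lambda>n. fps_nth F n * complex_of_real (1 / t) ^ n) \<longlonglongrightarrow> 0"
    by (intro summable_LIMSEQ_zero sums_summable)
  then have "(\<lambda>n. cmod (fps_nth F n * complex_of_real (1 / t) ^ n)) \<longlonglongrightarrow> 0"
    by (rule tendsto_norm_zero)
  moreover have "c \<le> cmod (fps_nth F n * complex_of_real (1 / t) ^ n)" for n
    using growth[of n] t by (simp add: F_def norm_mult norm_power norm_divide field_simps)
  ultimately have "c \<le> 0" by (intro LIMSEQ_le_const) auto
  then show False using c by simp
qed

section \<open>Elements of the complexified cones as rotated pairs\<close>

lemma cos_nonneg_imp_le_pi_half: "0 \<le> cos u \<Longrightarrow> \<bar>u\<bar> \<le> pi \<Longrightarrow> \<bar>u\<bar> \<le> pi / 2"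
  using cos_monotone_0_pi[of "pi / 2" "\<bar>u\<bar>"] by (cases "\<bar>u\<bar> \<le> pi / 2") auto

text \<open>Relative to a fixed nonzero element \<open>z0\<close> all arguments lie in \<open>[- pi / 2, pi / 2]\<close>, so no winding
  occurs and the pairwise condition bounds their differences by \<open>pi / 2\<close>. Rotating the infimum of
  the arguments to zero puts the set into the first quadrant.\<close>

lemma pairwise_acute_rotates_into_quadrant:
  fixes S :: "complex set"
  assumes acute: "\<And>z w. z \<in> S \<Longrightarrow> w \<in> S \<Longrightarrow> 0 \<le> Re (z * cnj w)"
  shows "\<exists>c. cmod c = 1 \<and> (\<forall>z\<in>S. 0 \<le> Re (c * z) \<and> 0 \<le> Im (c * z))"
proof (cases "S \<subseteq> {0}")
  case True
  then show ?thesis by (intro exI[of _ 1]) auto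
next
  case False
  then obtain z0 where z0: "z0 \<in> S" "z0 \<noteq> 0" by auto
  define a where "a z = Arg (z * cnj z0)" for z
  have polar: "z * cnj z0 = of_real (cmod (z * cnj z0)) * cis (a z)" for z
    by (metis a_def rcis_cmod_Arg rcis_def)
  have diff: "Re (z * cnj w) * (cmod z0)\<^sup>2 = cmod (z * cnj z0) * cmod (w * cnj z0) * cos (a z - a w)" for z w
  proof -
    have "z * cnj w * of_real ((cmod z0)\<^sup>2) = (z * cnj z0) * cnj (w * cnj z0)"
      unfolding complex_norm_square by (simp add: mult_ac)
    also have "\<dots> = of_real (cmod (z * cnj z0) * cmod (w * cnj z0)) * (cis (a z) * cnj (cis (a w)))"
    proof -
      have "(z * cnj z0) * cnj (w * cnj z0) =
          (of_real (cmod (z * cnj z0)) * cis (a z)) * cnj (of_real (cmod (w * cnj z0)) * cis (a w))"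
        by (rule arg_cong2[where f = "\<lambda>x y. x * cnj y", OF polar polar])
      then show ?thesis by (simp add: mult_ac)
    qed
    also have "cis (a z) * cnj (cis (a w)) = cis (a z - a w)"
      by (simp add: cis_cnj cis_mult)
    finally have "Re (z * cnj w * of_real ((cmod z0)\<^sup>2)) =
        Re (of_real (cmod (z * cnj z0) * cmod (w * cnj z0)) * cis (a z - a w))" by simp
    then show ?thesis by simp
  qed
  have cos: "0 \<le> cos (a z - a w)" if "z \<in> S - {0}" "w \<in> S - {0}" for z w
  proof -
    have "0 \<le> cmod (z * cnj z0) * cmod (w * cnj z0) * cos (a z - a w)"
      using acute[of z w] that by (simp add: diff[symmetric])
    moreover have "cmod (z * cnj z0) * cmod (w * cnj z0) > 0" using that z0 by simp
    ultimately show ?thesis by (metis mult_pos_neg not_less)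
  qed
  have a0: "a z0 = 0"
    using z0 by (simp add: a_def complex_norm_square[symmetric] del: of_real_power)
  have half: "\<bar>a z\<bar> \<le> pi / 2" if "z \<in> S - {0}" for z
    using cos[OF that, of z0] z0 a0 Arg_bounded[of "z * cnj z0"]
    by (intro cos_nonneg_imp_le_pi_half) (auto simp: a_def)
  have close: "\<bar>a z - a w\<bar> \<le> pi / 2" if "z \<in> S - {0}" "w \<in> S - {0}" for z w
    using cos[OF that] half[OF that(1)] half[OF that(2)] by (intro cos_nonneg_imp_le_pi_half) auto
  define \<theta> where "\<theta> = (INF z\<in>S - {0}. a z)"
  have "bdd_below (a ` (S - {0}))"
  proof (rule bdd_belowI2)
    show "- (pi / 2) \<le> a z" if "z \<in> S - {0}" for z using half[OF that] by linarith
  qed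
  then have low: "\<theta> \<le> a z" if "z \<in> S - {0}" for z
    unfolding \<theta>_def using that by (rule cINF_lower)
  have up: "a z - pi / 2 \<le> \<theta>" if "z \<in> S - {0}" for z
    unfolding \<theta>_def
  proof (rule cINF_greatest)
    show "S - {0} \<noteq> {}" using z0 by blast
    show "a z - pi / 2 \<le> a w" if "w \<in> S - {0}" for w
      using close[OF \<open>z \<in> S - {0}\<close> that] by linarith
  qed
  define c where "c = cis (- \<theta>) * cnj z0 / of_real (cmod z0)"
  have cz: "c * z = of_real (cmod z) * cis (a z - \<theta>)" for z
  proof -
    have "c * z = cis (- \<theta>) * (z * cnj z0) / of_real (cmod z0)" by (simp add: c_def mult_ac)
    also have "\<dots> = of_real (cmod z) * (cis (- \<theta>) * cis (a z))"
      by (subst polar) (use z0 in \<open>simp add: norm_mult\<close>)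
    finally show ?thesis by (simp add: cis_mult)
  qed
  show ?thesis
  proof (intro exI[of _ c] conjI ballI)
    show "cmod c = 1" using z0 by (simp add: c_def norm_mult norm_divide)
    fix z assume "z \<in> S"
    show "0 \<le> Re (c * z)"
    proof (cases "z = 0")
      case False
      then show ?thesis
        using low[of z] up[of z] \<open>z \<in> S\<close> by (auto simp: cz intro!: mult_nonneg_nonneg cos_ge_zero)
    qed simp
    show "0 \<le> Im (c * z)"
    proof (cases "z = 0")
      case False
      then show ?thesis
        using low[of z] up[of z] \<open>z \<in> S\<close> pi_gt_zero
        by (auto simp: cz intro!: mult_nonneg_nonneg sin_ge_zero)
    qed simp
  qed
qed

lemma cpair_add: "complexification \<iota> \<Longrightarrow> cpair \<iota> l (x + y) = cpair \<iota> l x + cpair \<iota> l y"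
  and cpair_scaleC: "complexification \<iota> \<Longrightarrow> cpair \<iota> l (c *\<^sub>C x) = c * cpair \<iota> l x"
  using cpair_bounded_clinear[of \<iota> l]
  by (auto simp: bounded_clinear_add bounded_clinear_functional_scaleC)

text \<open>The values of \<open>\<mu>\<close> on \<open>K\<close> are pairwise acute. After a rotation their real and imaginary parts are
  nonnegative, and these are the two functionals in the dual cone.\<close>

theorem complex_dual_cone_decomp:
  fixes \<iota> :: "'r::banach \<Rightarrow> 'a::complex_banach"
  assumes cx: "complexification \<iota>" and \<mu>: "\<mu> \<in> complex_dual_cone_of \<iota> K"
  obtains c l1 l2 where "cmod c = 1" "l1 \<in> dual_cone K" "l2 \<in> dual_cone K"
    "\<And>x. \<mu> x = c * (cpair \<iota> l1 x + \<i> * cpair \<iota> l2 x)"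
proof -
  have bc: "bounded_clinear \<mu>" using \<mu> by (simp add: complex_dual_cone_of_def)
  have "0 \<le> Re (z * cnj w)" if "z \<in> (\<lambda>u. \<mu> (\<iota> u)) ` K" "w \<in> (\<lambda>u. \<mu> (\<iota> u)) ` K" for z w
    using that \<mu> unfolding complex_dual_cone_of_def by blast
  then obtain d where d0: "cmod d = 1" "\<And>z. z \<in> (\<lambda>u. \<mu> (\<iota> u)) ` K \<Longrightarrow> 0 \<le> Re (d * z)"
      "\<And>z. z \<in> (\<lambda>u. \<mu> (\<iota> u)) ` K \<Longrightarrow> 0 \<le> Im (d * z)"
    using pairwise_acute_rotates_into_quadrant by metis
  have d: "cmod d = 1" "\<And>u. u \<in> K \<Longrightarrow> 0 \<le> Re (d * \<mu> (\<iota> u))"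
      "\<And>u. u \<in> K \<Longrightarrow> 0 \<le> Im (d * \<mu> (\<iota> u))"
    using d0(1) d0(2,3)[OF imageI] by simp_all
  have bl: "bounded_linear (\<lambda>u. d * \<mu> (\<iota> u))"
    by (intro bounded_linear_compose[OF bounded_linear_mult_right]
        bounded_linear_compose[OF bounded_clinear_imp_bounded_linear[OF bc] complexification_bounded_linear[OF cx]])
  define l1 where "l1 = Blinfun (\<lambda>u. Re (d * \<mu> (\<iota> u)))"
  define l2 where "l2 = Blinfun (\<lambda>u. Im (d * \<mu> (\<iota> u)))"
  have l1: "blinfun_apply l1 u = Re (d * \<mu> (\<iota> u))" for u
    unfolding l1_def
    by (subst bounded_linear_Blinfun_apply) (rule bounded_linear_compose[OF bounded_linear_Re bl] refl)+
  have l2: "blinfun_apply l2 u = Im (d * \<mu> (\<iota> u))" for u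
    unfolding l2_def
    by (subst bounded_linear_Blinfun_apply) (rule bounded_linear_compose[OF bounded_linear_Im bl] refl)+
  have dd: "cnj d * d = 1"
    using d(1) complex_norm_square[of d] by (simp add: mult.commute)
  show thesis
  proof (rule that[of "cnj d" l1 l2])
    show "cmod (cnj d) = 1" using d by simp
    show "l1 \<in> dual_cone K" "l2 \<in> dual_cone K" using d by (auto simp: dual_cone_def l1 l2)
    fix x
    define u v where "u = fst (re_im \<iota> x)" and "v = snd (re_im \<iota> x)"
    have x: "x = \<iota> u + \<i> *\<^sub>C \<iota> v" unfolding u_def v_def by (rule re_im_decomp[OF cx])
    have "d * \<mu> x = d * \<mu> (\<iota> u) + \<i> * (d * \<mu> (\<iota> v))"
      by (subst x) (simp add: bounded_clinear_add[OF bc] bounded_clinear_functional_scaleC[OF bc] algebra_simps)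
    also have "\<dots> = cpair \<iota> l1 x + \<i> * cpair \<iota> l2 x"
      unfolding cpair_decomp[OF cx x] by (simp add: complex_eq_iff l1 l2)
    finally have "cnj d * (d * \<mu> x) = cnj d * (cpair \<iota> l1 x + \<i> * cpair \<iota> l2 x)" by simp
    then show "\<mu> x = cnj d * (cpair \<iota> l1 x + \<i> * cpair \<iota> l2 x)"
      using dd by (simp only: mult.assoc[symmetric] mult_1_left)
  qed
qed

text \<open>Dually, the values at \<open>x\<close> of the functionals in the dual cone are pairwise acute. Separation turns
  nonnegativity on the dual cone back into membership in \<open>K\<close>.\<close>

theorem complex_cone_decomp:
  fixes \<iota> :: "'r::banach \<Rightarrow> 'a::complex_banach"
  assumes cx: "complexification \<iota>" and K: "real_cone K" and x: "x \<in> complex_cone_of \<iota> K"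
  obtains c u v where "cmod c = 1" "u \<in> K" "v \<in> K" "x = c *\<^sub>C (\<iota> u + \<i> *\<^sub>C \<iota> v)"
proof -
  have "0 \<le> Re (z * cnj w)" if "z \<in> (\<lambda>l. cpair \<iota> l x) ` dual_cone K" "w \<in> (\<lambda>l. cpair \<iota> l x) ` dual_cone K" for z w
    using that x unfolding complex_cone_of_def by blast
  then obtain d where d0: "cmod d = 1" "\<And>z. z \<in> (\<lambda>l. cpair \<iota> l x) ` dual_cone K \<Longrightarrow> 0 \<le> Re (d * z)"
      "\<And>z. z \<in> (\<lambda>l. cpair \<iota> l x) ` dual_cone K \<Longrightarrow> 0 \<le> Im (d * z)"
    using pairwise_acute_rotates_into_quadrant by metis
  have d: "cmod d = 1" "\<And>l. l \<in> dual_cone K \<Longrightarrow> 0 \<le> Re (d * cpair \<iota> l x)"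
      "\<And>l. l \<in> dual_cone K \<Longrightarrow> 0 \<le> Im (d * cpair \<iota> l x)"
    using d0(1) d0(2,3)[OF imageI] by simp_all
  define u v where "u = fst (re_im \<iota> (d *\<^sub>C x))" and "v = snd (re_im \<iota> (d *\<^sub>C x))"
  have dx: "d *\<^sub>C x = \<iota> u + \<i> *\<^sub>C \<iota> v" unfolding u_def v_def by (rule re_im_decomp[OF cx])
  have luv: "blinfun_apply l u = Re (d * cpair \<iota> l x)" "blinfun_apply l v = Im (d * cpair \<iota> l x)" for l
    using cpair_decomp[OF cx dx, of l] cpair_scaleC[OF cx, of l d x] by simp_all
  have dd: "cnj d * d = 1"
    using d(1) complex_norm_square[of d] by (simp add: mult.commute)
  show thesis
  proof (rule that[of "cnj d" u v])
    show "cmod (cnj d) = 1" using d by simp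
    show "u \<in> K"
    proof (rule ccontr)
      assume "u \<notin> K"
      then obtain l where "l \<in> dual_cone K" "blinfun_apply l u < 0" using real_cone_separation[OF K] by blast
      then show False using d(2)[of l] luv(1)[of l] by simp
    qed
    show "v \<in> K"
    proof (rule ccontr)
      assume "v \<notin> K"
      then obtain l where "l \<in> dual_cone K" "blinfun_apply l v < 0" using real_cone_separation[OF K] by blast
      then show False using d(3)[of l] luv(2)[of l] by simp
    qed
    show "x = cnj d *\<^sub>C (\<iota> u + \<i> *\<^sub>C \<iota> v)"
      unfolding dx[symmetric] by (simp add: scaleC_scaleC dd)
  qed
qed

text \<open>The real or the imaginary part of the rotated \<open>x\<close> is a nonzero \<open>w\<close> in \<open>K\<close>; as \<open>K\<close> is pointed,
  \<open>- w\<close> can be separated from \<open>K\<close>.\<close>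

lemma complex_cone_separated:
  fixes \<iota> :: "'r::banach \<Rightarrow> 'a::complex_banach"
  assumes cx: "complexification \<iota>" and K: "real_cone K" and x: "x \<in> complex_cone_of \<iota> K" "x \<noteq> 0"
  obtains l where "l \<in> dual_cone K" "cpair \<iota> l x \<noteq> 0"
proof -
  obtain c u v where c: "cmod c = 1" "u \<in> K" "v \<in> K" and xc: "x = c *\<^sub>C (\<iota> u + \<i> *\<^sub>C \<iota> v)"
    using complex_cone_decomp[OF cx K x(1)] by blast
  have "\<exists>w\<in>{u, v}. w \<noteq> 0"
    using x(2) xc linear_0[OF bounded_linear.linear[OF complexification_bounded_linear[OF cx]]] by auto
  then have "\<exists>w\<in>{u, v}. - w \<notin> K" using real_cone_pointed[OF K] c by blast
  then obtain w l where w: "w \<in> {u, v}" "l \<in> dual_cone K" "blinfun_apply l (- w) < 0"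
    using real_cone_separation[OF K] by metis
  have "cpair \<iota> l x = c * Complex (blinfun_apply l u) (blinfun_apply l v)"
    unfolding xc cpair_scaleC[OF cx] by (simp add: cpair_decomp[OF cx refl])
  moreover have "Complex (blinfun_apply l u) (blinfun_apply l v) \<noteq> 0"
    using w(1,3) by (auto simp: complex_eq_iff blinfun.minus_right)
  moreover have "c \<noteq> 0" using c(1) by auto
  ultimately have "cpair \<iota> l x \<noteq> 0" by simp
  then show thesis using w(2) that by blast
qed

section \<open>Invariance of the complexified cones\<close>

text \<open>A condition \<open>\<bar>g\<bar> \<le> h\<close> with linear \<open>g\<close> and \<open>h\<close> defines a convex cone, by the triangle inequality.\<close>

lemma pos_span_nonneg_form:
  fixes h :: "'v::real_vector \<Rightarrow> real" and g :: "'v \<Rightarrow> complex"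
  assumes h: "linear h" and g: "linear g" and gen: "\<And>u. u \<in> S \<Longrightarrow> cmod (g u) \<le> h u"
    and x: "x \<in> pos_span S"
  shows "cmod (g x) \<le> h x"
proof -
  obtain n :: nat and t u where x: "x = (\<Sum>k<n. t k *\<^sub>R u k)" "\<And>k. k < n \<Longrightarrow> 0 \<le> t k \<and> u k \<in> S"
    using x unfolding pos_span_def by blast
  have "cmod (g x) \<le> (\<Sum>k<n. cmod (t k *\<^sub>R g (u k)))"
    unfolding x linear_sum[OF g] linear_scale[OF g] by (rule norm_sum)
  also have "\<dots> \<le> (\<Sum>k<n. t k * h (u k))"
    using x(2) gen by (intro sum_mono) (auto intro: mult_left_mono)
  also have "\<dots> = h x"
    by (simp add: x linear_sum[OF h] linear_scale[OF h])
  finally show ?thesis .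
qed

text \<open>The convex cone \<open>\<bar>g\<bar> \<le> h\<close> is also closed. Factoring through \<open>p\<close> leaves a continuity condition on
  \<open>p\<close> only, as linear maps on a finite-dimensional space are continuous.\<close>

lemma generating_extends_bound:
  fixes p :: "'r::banach \<Rightarrow> complex \<times> complex"
  assumes gen: "generating K E" and p: "bounded_linear p"
    and h: "linear (h :: complex \<times> complex \<Rightarrow> real)" and g: "linear (g :: complex \<times> complex \<Rightarrow> complex)"
    and bound: "\<And>e. e \<in> E \<Longrightarrow> cmod (g (p e)) \<le> h (p e)" and x: "x \<in> K"
  shows "cmod (g (p x)) \<le> h (p x)"
proof -
  have hb: "bounded_linear h" and gb: "bounded_linear g"
    using h g by (simp_all add: linear_conv_bounded_linear)
  have hp: "bounded_linear (\<lambda>x. h (p x))" and gp: "bounded_linear (\<lambda>x. g (p x))"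
    using bounded_linear_compose[OF hb p] bounded_linear_compose[OF gb p] by auto
  have "closed {x. cmod (g (p x)) \<le> h (p x)}"
    by (intro closed_Collect_le continuous_on_norm linear_continuous_on hp gp)
  moreover have "pos_span E \<subseteq> {x. cmod (g (p x)) \<le> h (p x)}"
    using pos_span_nonneg_form[OF bounded_linear.linear[OF hp] bounded_linear.linear[OF gp] bound] by blast
  ultimately have "closure (pos_span E) \<subseteq> {x. cmod (g (p x)) \<le> h (p x)}"
    by (intro closure_minimal)
  then show ?thesis using gen x by (auto simp: generating_def)
qed

lemma cpair_linear_functional: "linear (\<lambda>l. cpair \<iota> l x)"
  by (rule linearI) (simp_all add: cpair_def blinfun.add_left blinfun.scaleR_left complex_eq_iff)

text \<open>Only the values at \<open>y\<close> and \<open>z\<close> matter, so weak-* approximation at these two vectors is ordinary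
  approximation in \<open>complex \<times> complex\<close>.\<close>

lemma weak_star_generating_extends_bound:
  fixes \<iota> :: "'r::banach \<Rightarrow> 'a::complex_banach"
  assumes gen: "weak_star_generating \<iota> K M"
    and h: "linear (h :: complex \<times> complex \<Rightarrow> real)" and g: "linear (g :: complex \<times> complex \<Rightarrow> complex)"
    and bound: "\<And>m. m \<in> M \<Longrightarrow> cmod (g (cpair \<iota> m y, cpair \<iota> m z)) \<le> h (cpair \<iota> m y, cpair \<iota> m z)"
    and l: "l \<in> dual_cone K"
  shows "cmod (g (cpair \<iota> l y, cpair \<iota> l z)) \<le> h (cpair \<iota> l y, cpair \<iota> l z)"
proof -
  define p where "p l = (cpair \<iota> l y, cpair \<iota> l z)" for l
  have p: "linear p"
    unfolding p_def
    by (rule linearI) (simp_all add: linear_add[OF cpair_linear_functional] linear_scale[OF cpair_linear_functional])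
  let ?C = "{w. cmod (g w) \<le> h w}"
  have closed: "closed ?C"
    using h g by (intro closed_Collect_le continuous_on_norm linear_continuous_on)
      (simp_all add: linear_conv_bounded_linear)
  have sub: "p ` pos_span M \<subseteq> ?C"
    using pos_span_nonneg_form[OF linear_compose[OF p h] linear_compose[OF p g]] bound
    by (auto simp: p_def o_def)
  have "p l \<in> closure (p ` pos_span M)"
    unfolding closure_approachable
  proof (intro allI impI)
    fix e :: real assume "e > 0"
    then obtain k where k: "k \<in> pos_span M" "\<forall>x\<in>{y, z}. cmod (cpair \<iota> k x - cpair \<iota> l x) < e / 2"
      using gen l unfolding weak_star_generating_def
      by (metis finite.emptyI finite.insertI half_gt_zero)
    have "dist (p k) (p l) \<le> dist (cpair \<iota> k y) (cpair \<iota> l y) + dist (cpair \<iota> k z) (cpair \<iota> l z)"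
      unfolding p_def dist_Pair_Pair by (rule sqrt_sum_squares_le_sum) simp_all
    also have "\<dots> < e" using k(2) by (simp add: dist_norm)
    finally show "\<exists>w\<in>p ` pos_span M. dist w (p l) < e" using k(1) by blast
  qed
  also have "closure (p ` pos_span M) \<subseteq> ?C" by (rule closure_minimal[OF sub closed])
  finally show ?thesis by (simp add: p_def)
qed

text \<open>The first inequality in \<open>Gamma_bar\<close>. Both the determinant and \<open>Re (a * cnj d + b * cnj c)\<close> are
  real-linear in each row and in each column.\<close>

definition det_dominated :: "complex \<Rightarrow> complex \<Rightarrow> complex \<Rightarrow> complex \<Rightarrow> bool" where
  "det_dominated a b c d \<longleftrightarrow> cmod (a * d - b * c) \<le> Re (a * cnj d + b * cnj c)"

lemma det_dominated_swap_cols: "det_dominated a b c d \<longleftrightarrow> det_dominated b a d c"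
  and det_dominated_swap_rows: "det_dominated a b c d \<longleftrightarrow> det_dominated c d a b"
  and det_dominated_transpose: "det_dominated a b c d \<longleftrightarrow> det_dominated a c b d"
  by (simp_all add: det_dominated_def norm_minus_commute[of "a * d"] algebra_simps)

text \<open>With \<open>k = a d* + b c*\<close>, \<open>p = Re (a b*)\<close>, \<open>q = Re (c d*)\<close>, the value in question is
  \<open>p + q + Im k\<close>. The identity \<open>\<bar>k\<bar>\<^sup>2 - \<bar>a d - b c\<bar>\<^sup>2 = 4 p q\<close> turns the hypothesis into
  \<open>(Im k)\<^sup>2 \<le> 4 p q\<close>, and the arithmetic-geometric mean inequality concludes.\<close>

lemma det_dominated_imp_form_nonneg:
  assumes D: "det_dominated a b c d" and row1: "0 \<le> Re (a * cnj b)" and row2: "0 \<le> Re (c * cnj d)"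
  shows "0 \<le> Re ((a + \<i> * c) * cnj (b + \<i> * d))"
proof -
  define k where "k = a * cnj d + b * cnj c"
  define p q where "p = Re (a * cnj b)" and "q = Re (c * cnj d)"
  have id: "(cmod k)\<^sup>2 - (cmod (a * d - b * c))\<^sup>2 = 4 * p * q"
    unfolding k_def p_def q_def cmod_power2 by (simp add: algebra_simps power2_eq_square)
  have "(cmod (a * d - b * c))\<^sup>2 \<le> (Re k)\<^sup>2"
    using D by (intro power_mono) (auto simp: det_dominated_def k_def)
  then have "(Im k)\<^sup>2 \<le> 4 * p * q"
    using id cmod_power2[of k] by simp
  also have "\<dots> \<le> (p + q)\<^sup>2"
    using zero_le_power2[of "p - q"] by (simp add: power2_eq_square algebra_simps)
  finally have "\<bar>Im k\<bar> \<le> p + q"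
    using row1 row2 by (intro power2_le_imp_le[of "\<bar>Im k\<bar>"]) (auto simp: p_def q_def)
  moreover have "Re ((a + \<i> * c) * cnj (b + \<i> * d)) = p + q + Im k"
    by (simp add: p_def q_def k_def algebra_simps)
  ultimately show ?thesis by linarith
qed

lemma unimodular_mult_cnj:
  assumes "cmod c = 1"
  shows "(c * y) * cnj (c * z) = y * cnj z"
proof -
  have "(c * y) * cnj (c * z) = (c * cnj c) * (y * cnj z)" by (simp add: mult_ac)
  then show ?thesis using complex_norm_square[of c] assms by simp
qed

text \<open>Equal rows or columns make the determinant vanish. This is how positivity on each single row or
  column is read off from the inequality for pairs.\<close>

lemma det_dominated_same_cols: "det_dominated a a c c \<longleftrightarrow> 0 \<le> Re (a * cnj c)"
  and det_dominated_same_rows: "det_dominated a b a b \<longleftrightarrow> 0 \<le> Re (a * cnj b)"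
  by (auto simp: det_dominated_def algebra_simps)

lemma det_dominated_on_generators:
  fixes \<iota> :: "'r::banach \<Rightarrow> 'a::complex_banach"
  assumes T: "test_matrices \<iota> E M A \<subseteq> Gamma_bar"
    and "e1 \<in> E" "e2 \<in> E" "m1 \<in> M" "m2 \<in> M"
  shows "det_dominated (cpair \<iota> m1 (A (\<iota> e1))) (cpair \<iota> m2 (A (\<iota> e1)))
    (cpair \<iota> m1 (A (\<iota> e2))) (cpair \<iota> m2 (A (\<iota> e2)))"
proof -
  have "pairing_matrix \<iota> m1 m2 (A (\<iota> e1)) (A (\<iota> e2)) \<in> Gamma_bar"
    using T assms unfolding test_matrices_def by blast
  then show ?thesis
    by (simp add: Gamma_bar_def pairing_matrix_def Let_def det_dominated_def)
qed

lemma det_dominated_extend_functional: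
  fixes \<iota> :: "'r::banach \<Rightarrow> 'a::complex_banach"
  assumes gM: "weak_star_generating \<iota> K M"
    and "\<And>m. m \<in> M \<Longrightarrow> det_dominated (cpair \<iota> m y) b (cpair \<iota> m z) d" and "l \<in> dual_cone K"
  shows "det_dominated (cpair \<iota> l y) b (cpair \<iota> l z) d"
proof -
  define h where "h w = Re (fst w * cnj d + b * cnj (snd w))" for w
  define g where "g w = fst w * d - b * snd w" for w
  have "linear h" "linear g"
    unfolding h_def g_def by (auto intro!: linearI simp: algebra_simps)
  from weak_star_generating_extends_bound[OF gM this, of y z l] assms show ?thesis
    by (simp add: det_dominated_def h_def g_def)
qed

lemma det_dominated_extend_vector:
  fixes \<iota> :: "'r::banach \<Rightarrow> 'a::complex_banach"
  assumes cx: "complexification \<iota>" and gE: "generating K E" and A: "bounded_clinear A"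
    and bound: "\<And>e. e \<in> E \<Longrightarrow> det_dominated (cpair \<iota> l1 (A (\<iota> e))) (cpair \<iota> l2 (A (\<iota> e))) c d" and u: "u \<in> K"
  shows "det_dominated (cpair \<iota> l1 (A (\<iota> u))) (cpair \<iota> l2 (A (\<iota> u))) c d"
proof -
  define h where "h w = Re (fst w * cnj d + snd w * cnj c)" for w
  define g where "g w = fst w * d - snd w * c" for w
  have hg: "linear h" "linear g"
    unfolding h_def g_def by (auto intro!: linearI simp: algebra_simps)
  have "bounded_linear (\<lambda>u. cpair \<iota> l (A (\<iota> u)))" for l
    by (intro bounded_linear_compose[OF bounded_clinear_imp_bounded_linear[OF cpair_bounded_clinear[OF cx]]]
        bounded_linear_compose[OF bounded_clinear_imp_bounded_linear[OF A]] complexification_bounded_linear[OF cx])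
  then have "bounded_linear (\<lambda>u. (cpair \<iota> l1 (A (\<iota> u)), cpair \<iota> l2 (A (\<iota> u))))"
    by (intro bounded_linear_Pair)
  from generating_extends_bound[OF gE this hg _ u] bound show ?thesis
    by (simp add: det_dominated_def h_def g_def)
qed

text \<open>Each of the four arguments enters through one row or one column, so they are extended one at a time;
  the two symmetries bring each of them into the first position.\<close>

lemma det_dominated_on_cones:
  fixes \<iota> :: "'r::banach \<Rightarrow> 'a::complex_banach"
  assumes cx: "complexification \<iota>" and gE: "generating K E"
    and gM: "weak_star_generating \<iota> K M" and A: "bounded_clinear A"
    and T: "test_matrices \<iota> E M A \<subseteq> Gamma_bar"
    and "u \<in> K" "v \<in> K" "l1 \<in> dual_cone K" "l2 \<in> dual_cone K"
  shows "det_dominated (cpair \<iota> l1 (A (\<iota> u))) (cpair \<iota> l2 (A (\<iota> u)))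
    (cpair \<iota> l1 (A (\<iota> v))) (cpair \<iota> l2 (A (\<iota> v)))"
proof -
  let ?D = "\<lambda>u v l1 l2. det_dominated (cpair \<iota> l1 (A (\<iota> u))) (cpair \<iota> l2 (A (\<iota> u)))
    (cpair \<iota> l1 (A (\<iota> v))) (cpair \<iota> l2 (A (\<iota> v)))"
  have 1: "?D e1 e2 k m" if "e1 \<in> E" "e2 \<in> E" "k \<in> dual_cone K" "m \<in> M" for e1 e2 k m
    by (rule det_dominated_extend_functional[OF gM det_dominated_on_generators[OF T]]) (use that in simp_all)
  have 2: "?D e1 e2 l k" if "e1 \<in> E" "e2 \<in> E" "k \<in> dual_cone K" "l \<in> dual_cone K" for e1 e2 k l
    by (rule det_dominated_extend_functional[OF gM 1[THEN det_dominated_swap_cols[THEN iffD1]]])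
      (use that in simp_all)
  have 3: "?D w e2 l k" if "w \<in> K" "e2 \<in> E" "k \<in> dual_cone K" "l \<in> dual_cone K" for w e2 k l
    by (rule det_dominated_extend_vector[OF cx gE A 2]) (use that in simp_all)
  have "?D v u l1 l2"
    by (rule det_dominated_extend_vector[OF cx gE A 3[THEN det_dominated_swap_rows[THEN iffD1]]])
      (use assms in simp_all)
  then show ?thesis by (rule det_dominated_swap_rows[THEN iffD1])
qed

text \<open>The decomposition reduces the claim to \<open>x = u + i v\<close>, where it is the inequality on the cones for
  the rows \<open>u, v\<close>.\<close>

theorem complex_cone_invariant:
  fixes \<iota> :: "'r::banach \<Rightarrow> 'a::complex_banach"
  assumes cx: "complexification \<iota>" and K: "real_cone K" and gE: "generating K E"
    and gM: "weak_star_generating \<iota> K M" and A: "bounded_clinear A"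
    and T: "test_matrices \<iota> E M A \<subseteq> Gamma_bar"
    and x: "x \<in> complex_cone_of \<iota> K"
  shows "A x \<in> complex_cone_of \<iota> K"
  unfolding complex_cone_of_def
proof (intro CollectI ballI)
  fix l1 l2 assume l: "l1 \<in> dual_cone K" "l2 \<in> dual_cone K"
  obtain c u v where c: "cmod c = 1" "u \<in> K" "v \<in> K" and x': "x = c *\<^sub>C (\<iota> u + \<i> *\<^sub>C \<iota> v)"
    using complex_cone_decomp[OF cx K x] by blast
  have cl: "cpair \<iota> l (A x) = c * (cpair \<iota> l (A (\<iota> u)) + \<i> * cpair \<iota> l (A (\<iota> v)))" for l
    by (simp add: x' bounded_clinear_scaleC[OF A] bounded_clinear_add[OF A] cpair_scaleC[OF cx] cpair_add[OF cx])
  have "0 \<le> Re ((cpair \<iota> l1 (A (\<iota> u)) + \<i> * cpair \<iota> l1 (A (\<iota> v))) *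
      cnj (cpair \<iota> l2 (A (\<iota> u)) + \<i> * cpair \<iota> l2 (A (\<iota> v))))"
  proof (rule det_dominated_imp_form_nonneg)
    show "det_dominated (cpair \<iota> l1 (A (\<iota> u))) (cpair \<iota> l2 (A (\<iota> u)))
        (cpair \<iota> l1 (A (\<iota> v))) (cpair \<iota> l2 (A (\<iota> v)))"
      using c l by (intro det_dominated_on_cones[OF cx gE gM A T])
    have "0 \<le> Re (cpair \<iota> l1 (A (\<iota> w)) * cnj (cpair \<iota> l2 (A (\<iota> w))))" if "w \<in> K" for w
      using det_dominated_on_cones[OF cx gE gM A T that that l] by (simp only: det_dominated_same_rows)
    then show "0 \<le> Re (cpair \<iota> l1 (A (\<iota> u)) * cnj (cpair \<iota> l2 (A (\<iota> u))))"
      "0 \<le> Re (cpair \<iota> l1 (A (\<iota> v)) * cnj (cpair \<iota> l2 (A (\<iota> v))))" using c by simp_all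
  qed
  then show "0 \<le> Re (cpair \<iota> l1 (A x) * cnj (cpair \<iota> l2 (A x)))"
    unfolding cl unimodular_mult_cnj[OF c(1)] .
qed

text \<open>The same computation with the transposed matrix, for \<open>\<mu> = l1 + i l2\<close>.\<close>

theorem complex_dual_cone_invariant:
  fixes \<iota> :: "'r::banach \<Rightarrow> 'a::complex_banach"
  assumes cx: "complexification \<iota>" and gE: "generating K E"
    and gM: "weak_star_generating \<iota> K M" and A: "bounded_clinear A"
    and T: "test_matrices \<iota> E M A \<subseteq> Gamma_bar"
    and \<mu>: "\<mu> \<in> complex_dual_cone_of \<iota> K"
  shows "(\<lambda>x. \<mu> (A x)) \<in> complex_dual_cone_of \<iota> K"
  unfolding complex_dual_cone_of_def
proof (intro CollectI conjI ballI)
  show "bounded_clinear (\<lambda>x. \<mu> (A x))"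
    using \<mu> by (intro bounded_clinear_compose[OF _ A]) (simp add: complex_dual_cone_of_def)
  fix u v assume uv: "u \<in> K" "v \<in> K"
  obtain c l1 l2 where c: "cmod c = 1" and l: "l1 \<in> dual_cone K" "l2 \<in> dual_cone K"
    and \<mu>': "\<And>x. \<mu> x = c * (cpair \<iota> l1 x + \<i> * cpair \<iota> l2 x)"
    using complex_dual_cone_decomp[OF cx \<mu>] by blast
  have "0 \<le> Re ((cpair \<iota> l1 (A (\<iota> u)) + \<i> * cpair \<iota> l2 (A (\<iota> u))) *
      cnj (cpair \<iota> l1 (A (\<iota> v)) + \<i> * cpair \<iota> l2 (A (\<iota> v))))"
  proof (rule det_dominated_imp_form_nonneg)
    show "det_dominated (cpair \<iota> l1 (A (\<iota> u))) (cpair \<iota> l1 (A (\<iota> v)))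
        (cpair \<iota> l2 (A (\<iota> u))) (cpair \<iota> l2 (A (\<iota> v)))"
      using det_dominated_on_cones[OF cx gE gM A T uv l] by (rule det_dominated_transpose[THEN iffD1])
    have "0 \<le> Re (cpair \<iota> l (A (\<iota> u)) * cnj (cpair \<iota> l (A (\<iota> v))))" if "l \<in> dual_cone K" for l
      using det_dominated_on_cones[OF cx gE gM A T uv that that] by (simp only: det_dominated_same_cols)
    then show "0 \<le> Re (cpair \<iota> l1 (A (\<iota> u)) * cnj (cpair \<iota> l1 (A (\<iota> v))))"
      "0 \<le> Re (cpair \<iota> l2 (A (\<iota> u)) * cnj (cpair \<iota> l2 (A (\<iota> v))))" using l by simp_all
  qed
  then show "0 \<le> Re (\<mu> (A (\<iota> u)) * cnj (\<mu> (A (\<iota> v))))"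
    unfolding \<mu>' unimodular_mult_cnj[OF c] .
qed

section \<open>Domination for two by two matrices\<close>

lemma rank_eq_2_iff_det: "rank (M :: 'f::field^2^2) = 2 \<longleftrightarrow> det M \<noteq> 0"
proof -
  have "rank M = 2 \<longleftrightarrow> vec.span (rows M) = UNIV"
    unfolding row_rank_def_gen using vec.dim_eq_full[of "rows M"] by (simp add: vec.dimension_def card_cart_basis)
  then show ?thesis
    by (simp add: matrix_left_invertible_span_rows_gen[symmetric] invertible_left_inverse[symmetric] invertible_det_nz)
qed

lemma rank_eq_1_iff_det: "rank (M :: 'f::field^2^2) = 1 \<longleftrightarrow> det M = 0 \<and> M \<noteq> 0"
proof -
  have "rank M \<le> 2"
    unfolding row_rank_def_gen using vec.dim_subset_UNIV[of "rows M"] by (simp add: vec.dimension_def card_cart_basis)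
  moreover have "rank M = 0 \<longleftrightarrow> M = 0"
  proof -
    have "rank M = 0 \<longleftrightarrow> rows M \<subseteq> {0}" unfolding row_rank_def_gen by (rule vec.dim_eq_0)
    also have "\<dots> \<longleftrightarrow> (\<forall>i. row i M = 0)" unfolding rows_def by auto
    also have "\<dots> \<longleftrightarrow> M = 0" by (simp add: row_def vec_eq_iff)
    finally show ?thesis .
  qed
  ultimately show ?thesis using rank_eq_2_iff_det[of M] by auto
qed

text \<open>For \<open>Re (s * cnj r) \<ge> 0\<close> consider the condition \<open>t \<bar>s c + r d\<bar> \<le> \<bar>s a + r b\<bar>\<close>. The diagonal
  instances \<open>gap_form t a a c c\<close> and \<open>gap_form t b b d d\<close> say that it holds for \<open>(s, r) = (1, 0)\<close>
  and \<open>(0, 1)\<close>; the general instance controls the cross terms. In this form, real-linear in each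
  column up to the modulus of the determinant, the control survives positive combinations of columns;
  a bound of the cross term by the geometric mean of the diagonal gaps would not.\<close>

definition gap_form :: "real \<Rightarrow> complex \<Rightarrow> complex \<Rightarrow> complex \<Rightarrow> complex \<Rightarrow> bool" where
  "gap_form t a b c d \<longleftrightarrow> t * cmod (a * d - b * c) \<le> Re (a * cnj b) - t\<^sup>2 * Re (c * cnj d)"

lemma gap_form_swap: "gap_form t a b c d \<longleftrightarrow> gap_form t b a d c"
  by (simp add: gap_form_def norm_minus_commute[of "a * d"] algebra_simps)

lemma gap_form_diag: "t \<ge> 0 \<Longrightarrow> gap_form t a a c c \<longleftrightarrow> t * cmod c \<le> cmod a"
proof -
  assume t: "t \<ge> 0"
  have sq: "Re (z * cnj z) = (cmod z)\<^sup>2" for z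
    unfolding cmod_power2 by (simp add: power2_eq_square)
  have "gap_form t a a c c \<longleftrightarrow> (t * cmod c)\<^sup>2 \<le> (cmod a)\<^sup>2"
    unfolding gap_form_def sq power_mult_distrib by simp
  also have "\<dots> \<longleftrightarrow> t * cmod c \<le> cmod a"
    using t abs_le_square_iff[of "t * cmod c" "cmod a"] by simp
  finally show ?thesis .
qed

text \<open>The determinant of the Hermitian form \<open>\<bar>s a + r b\<bar>\<^sup>2 - t\<^sup>2 \<bar>s c + r d\<bar>\<^sup>2\<close> in \<open>(s, r)\<close> is
  \<open>- t\<^sup>2 \<bar>a d - b c\<bar>\<^sup>2\<close>.\<close>

lemma gap_identity:
  "((cmod a)\<^sup>2 - t\<^sup>2 * (cmod c)\<^sup>2) * ((cmod b)\<^sup>2 - t\<^sup>2 * (cmod d)\<^sup>2) =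
    (cmod (a * cnj b - of_real (t\<^sup>2) * (c * cnj d)))\<^sup>2 - t\<^sup>2 * (cmod (a * d - b * c))\<^sup>2"
  unfolding cmod_power2 by (simp add: power2_eq_square) algebra

text \<open>Let \<open>P\<close>, \<open>Q\<close> be the diagonal coefficients of the Hermitian form and \<open>w\<close> the off-diagonal one.
  The hypothesis \<open>t \<bar>a d - b c\<bar> \<le> Re w\<close> and the determinant identity give \<open>(Im w)\<^sup>2 \<le> P Q\<close>, and
  the form takes the value \<open>P + Q + 2 Im w\<close> at \<open>(1, i)\<close>.\<close>

lemma gap_form_imp_dominated:
  assumes t: "t \<ge> 0" and aa: "gap_form t a a c c" and bb: "gap_form t b b d d" and ab: "gap_form t a b c d"
  shows "t * cmod (c + \<i> * d) \<le> cmod (a + \<i> * b)"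
proof -
  define P Q where "P = (cmod a)\<^sup>2 - t\<^sup>2 * (cmod c)\<^sup>2" and "Q = (cmod b)\<^sup>2 - t\<^sup>2 * (cmod d)\<^sup>2"
  define w where "w = a * cnj b - of_real (t\<^sup>2) * (c * cnj d)"
  have P: "P \<ge> 0" and Q: "Q \<ge> 0"
    using aa bb t unfolding gap_form_diag[OF t] P_def Q_def power_mult_distrib[symmetric]
    by (simp_all add: power_mono)
  have "t * cmod (a * d - b * c) \<le> Re w"
    using ab by (simp add: gap_form_def w_def)
  then have "(t * cmod (a * d - b * c))\<^sup>2 \<le> (Re w)\<^sup>2"
    using t by (intro power_mono) auto
  then have "(Im w)\<^sup>2 \<le> P * Q"
    using gap_identity[of a t c b d] cmod_power2[of w]
    by (simp add: P_def Q_def w_def power_mult_distrib)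
  then have "(2 * Im w)\<^sup>2 \<le> (P + Q)\<^sup>2"
    using zero_le_power2[of "P - Q"] by (simp add: power2_eq_square algebra_simps)
  then have "\<bar>2 * Im w\<bar> \<le> P + Q"
    using P Q by (metis abs_le_square_iff abs_of_nonneg add_nonneg_nonneg)
  moreover have "(cmod (a + \<i> * b))\<^sup>2 - (t * cmod (c + \<i> * d))\<^sup>2 = P + Q + 2 * Im w"
    unfolding P_def Q_def w_def power_mult_distrib cmod_power2 by (simp add: power2_eq_square) algebra
  ultimately have "(t * cmod (c + \<i> * d))\<^sup>2 \<le> (cmod (a + \<i> * b))\<^sup>2" by linarith
  then show ?thesis by (rule power2_le_imp_le) simp
qed

text \<open>Nonnegativity of the form is known only on the positive quadrant, which suffices because the
  minimising direction of \<open>x\<^sup>2 P - 2 x y r + y\<^sup>2 Q\<close> lies there.\<close>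

lemma real_quadratic_discriminant:
  fixes P Q r :: real
  assumes "P \<ge> 0" "Q \<ge> 0" "r \<ge> 0"
    and form: "\<And>x y. x \<ge> 0 \<Longrightarrow> y \<ge> 0 \<Longrightarrow> 2 * x * y * r \<le> x\<^sup>2 * P + y\<^sup>2 * Q"
  shows "r\<^sup>2 \<le> P * Q"
proof (cases "P = 0")
  case True
  have "2 * (Q + 1) * r * r \<le> r\<^sup>2 * Q"
    using form[of "Q + 1" r] assms True by simp
  then have "r\<^sup>2 * (Q + 2) \<le> 0" by (simp add: power2_eq_square algebra_simps)
  then have "r\<^sup>2 \<le> 0" using assms by (simp add: mult_le_0_iff)
  then show ?thesis using True by simp
next
  case False
  have "2 * r\<^sup>2 / P \<le> r\<^sup>2 / P + Q"
    using form[of "r / P" 1] assms False by (simp add: power2_eq_square field_simps)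
  then show ?thesis using False assms by (simp add: field_simps)
qed

lemma dependent_rows_obtain_ratio:
  fixes a b c d :: "'f::field"
  assumes "a * d - b * c = 0" "c \<noteq> 0 \<or> d \<noteq> 0"
  obtains \<rho> where "a = \<rho> * c" "b = \<rho> * d"
proof (cases "c = 0")
  case True
  then show thesis using assms by (intro that[of "b / d"]) auto
next
  case False
  then show thesis using assms by (intro that[of "a / c"]) (auto simp: field_simps)
qed

text \<open>Test vectors \<open>(x \<sigma>, y)\<close> with a unimodular \<open>\<sigma>\<close>, \<open>Re \<sigma> \<ge> 0\<close>, turn domination into real quadratic
  forms. If \<open>Re w \<ge> 0\<close>, the extreme choices \<open>\<sigma> = i\<close> and \<open>\<sigma> = - i\<close> yield \<open>(Im w)\<^sup>2 \<le> P Q\<close>, hence the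
  claim. If \<open>Re w < 0\<close>, the direction opposite to \<open>w\<close> is admissible and yields \<open>\<bar>w\<bar>\<^sup>2 \<le> P Q\<close>; this
  kills \<open>t\<close> or the determinant, and then the sign conditions and the diagonal inequalities give
  \<open>Re w \<ge> 0\<close> after all.\<close>

lemma dominated_imp_gap_form:
  assumes t: "t \<ge> 0" and row1: "0 \<le> Re (a * cnj b)" and row2: "0 \<le> Re (c * cnj d)"
    and dom: "\<And>s r. 0 \<le> Re (s * cnj r) \<Longrightarrow> t * cmod (s * c + r * d) \<le> cmod (s * a + r * b)"
  shows "gap_form t a b c d"
proof -
  define P Q where "P = (cmod a)\<^sup>2 - t\<^sup>2 * (cmod c)\<^sup>2" and "Q = (cmod b)\<^sup>2 - t\<^sup>2 * (cmod d)\<^sup>2"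
  define w where "w = a * cnj b - of_real (t\<^sup>2) * (c * cnj d)"
  have ac: "t * cmod c \<le> cmod a" and bd: "t * cmod d \<le> cmod b"
    using dom[of 1 0] dom[of 0 1] by simp_all
  have P: "P \<ge> 0" and Q: "Q \<ge> 0"
    using ac bd t unfolding P_def Q_def power_mult_distrib[symmetric] by (simp_all add: power_mono)
  have form: "0 \<le> x\<^sup>2 * P + y\<^sup>2 * Q + 2 * x * y * Re (\<sigma> * w)"
    if "x \<ge> 0" "y \<ge> 0" "cmod \<sigma> = 1" "Re \<sigma> \<ge> 0" for x y \<sigma>
  proof -
    let ?s = "of_real x * \<sigma>" and ?r = "of_real y :: complex"
    have "0 \<le> Re (?s * cnj ?r)" using that by simp
    from dom[OF this] have "(t * cmod (?s * c + ?r * d))\<^sup>2 \<le> (cmod (?s * a + ?r * b))\<^sup>2"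
      using t by (intro power_mono) auto
    moreover have "(cmod (?s * a + ?r * b))\<^sup>2 - (t * cmod (?s * c + ?r * d))\<^sup>2 =
        x\<^sup>2 * (cmod \<sigma>)\<^sup>2 * P + y\<^sup>2 * Q + 2 * x * y * Re (\<sigma> * w)"
      unfolding P_def Q_def w_def power_mult_distrib cmod_power2 by (simp add: power2_eq_square) algebra
    ultimately show ?thesis using that(3) by simp
  qed
  have id: "P * Q = (cmod w)\<^sup>2 - (t * cmod (a * d - b * c))\<^sup>2"
    using gap_identity[of a t c b d] by (simp add: P_def Q_def w_def power_mult_distrib)
  show ?thesis
  proof (cases "Re w \<ge> 0")
    case True
    have "\<bar>Im w\<bar>\<^sup>2 \<le> P * Q"
    proof (rule real_quadratic_discriminant[OF P Q])
      fix x y :: real assume "x \<ge> 0" "y \<ge> 0"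
      from form[OF this, of \<i>] form[OF this, of "- \<i>"]
      show "2 * x * y * \<bar>Im w\<bar> \<le> x\<^sup>2 * P + y\<^sup>2 * Q" by (auto simp: abs_if)
    qed simp
    then have "(t * cmod (a * d - b * c))\<^sup>2 \<le> (Re w)\<^sup>2"
      using id cmod_power2[of w] by simp
    then have "t * cmod (a * d - b * c) \<le> Re w" using True by (rule power2_le_imp_le)
    then show ?thesis by (simp add: gap_form_def w_def)
  next
    case False
    then have w: "w \<noteq> 0" by auto
    have "(cmod w)\<^sup>2 \<le> P * Q"
    proof (rule real_quadratic_discriminant[OF P Q])
      fix x y :: real assume xy: "x \<ge> 0" "y \<ge> 0"
      let ?\<sigma> = "- cnj w / of_real (cmod w)"
      have "?\<sigma> * w = - of_real (cmod w)"
        using w complex_norm_square[of w] by (simp add: field_simps power2_eq_square)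
      then show "2 * x * y * cmod w \<le> x\<^sup>2 * P + y\<^sup>2 * Q"
        using form[OF xy, of ?\<sigma>] w False by (simp add: norm_divide divide_nonpos_pos)
    qed simp
    then have zero: "t * cmod (a * d - b * c) = 0" using id by simp
    have "0 \<le> Re w"
    proof (cases "t = 0 \<or> (c = 0 \<and> d = 0)")
      case True
      then show ?thesis using row1 by (auto simp: w_def)
    next
      case nontriv: False
      then obtain \<rho> where \<rho>: "a = \<rho> * c" "b = \<rho> * d"
        using zero dependent_rows_obtain_ratio[of a d b c] by auto
      have "t \<le> cmod \<rho>"
        using ac bd nontriv by (auto simp: \<rho> norm_mult)
      then have "t\<^sup>2 \<le> (cmod \<rho>)\<^sup>2" using t by (intro power_mono)
      moreover have "Re w = ((cmod \<rho>)\<^sup>2 - t\<^sup>2) * Re (c * cnj d)"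
        unfolding w_def \<rho> cmod_power2 by (simp add: power2_eq_square) algebra
      ultimately show ?thesis using row2 by simp
    qed
    with False show ?thesis by simp
  qed
qed

text \<open>Were the diagonal gap negative at \<open>t\<close>, it would vanish at some smaller \<open>s\<close>. There the right hand side
  of \<open>gap_identity\<close> must vanish too, but a nonzero determinant makes the cross inequality
  strict at \<open>s\<close>.\<close>

lemma gap_form_imp_diag:
  assumes t: "t \<ge> 0" and det: "a * d - b * c \<noteq> 0" and row2: "0 \<le> Re (c * cnj d)"
    and gap: "gap_form t a b c d"
  shows "gap_form t a a c c"
proof (rule ccontr)
  assume "\<not> gap_form t a a c c"
  then have lt: "cmod a < t * cmod c" by (simp add: gap_form_diag[OF t])
  then have c: "cmod c > 0" using t by (cases "c = 0") auto
  \<comment> \<open>The parameter at which the diagonal gap is zero.\<close>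
  define s where "s = cmod a / cmod c"
  have s: "0 \<le> s" "s < t" using lt c by (auto simp: s_def field_simps)
  define w where "w = a * cnj b - of_real (s\<^sup>2) * (c * cnj d)"
  have "s * cmod (a * d - b * c) + s\<^sup>2 * Re (c * cnj d) < t * cmod (a * d - b * c) + t\<^sup>2 * Re (c * cnj d)"
    using s det row2 by (intro add_less_le_mono mult_right_mono power_mono mult_strict_right_mono) auto
  also have "\<dots> \<le> Re (a * cnj b)" using gap by (simp add: gap_form_def)
  finally have "s * cmod (a * d - b * c) < Re w" by (simp add: w_def)
  also have "\<dots> \<le> cmod w" by (rule complex_Re_le_cmod)
  finally have "(s * cmod (a * d - b * c))\<^sup>2 < (cmod w)\<^sup>2"
    using s by (intro power_strict_mono) auto
  moreover have "(cmod a)\<^sup>2 - s\<^sup>2 * (cmod c)\<^sup>2 = 0"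
    using c by (simp add: s_def power_divide)
  ultimately show False
    using gap_identity[of a s c b d] by (simp add: w_def power_mult_distrib)
qed

text \<open>Since \<open>k\<^sup>2 = \<delta>\<^sup>2 + 4 p q\<close>, the number \<open>2 p / (k + \<delta>)\<close> is the nonnegative root of
  \<open>q t\<^sup>2 + \<delta> t - p\<close>, in the form that remains meaningful for \<open>q = 0\<close>.\<close>

lemma le_root_iff_gap:
  fixes t p q k \<delta> :: real
  assumes "t \<ge> 0" "p \<ge> 0" "q \<ge> 0" "k \<ge> 0" "\<delta> > 0" and k: "k\<^sup>2 - \<delta>\<^sup>2 = 4 * p * q"
  shows "t \<le> 2 * p / (k + \<delta>) \<longleftrightarrow> t * \<delta> \<le> p - t\<^sup>2 * q"
proof -
  have "t \<le> 2 * p / (k + \<delta>) \<longleftrightarrow> t * k \<le> 2 * p - t * \<delta>"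
    using assms by (simp add: pos_le_divide_eq algebra_simps)
  also have "\<dots> \<longleftrightarrow> t * \<delta> \<le> p - t\<^sup>2 * q"
  proof
    assume L: "t * k \<le> 2 * p - t * \<delta>"
    show "t * \<delta> \<le> p - t\<^sup>2 * q"
    proof (cases "p = 0")
      case True
      then have "t * k + t * \<delta> \<le> 0" using L by simp
      moreover have "t * k \<ge> 0" "t * \<delta> \<ge> 0" using assms by auto
      ultimately have "t = 0" using assms by (smt (verit) mult_eq_0_iff)
      then show ?thesis using True by simp
    next
      case False
      have "(t * k)\<^sup>2 \<le> (2 * p - t * \<delta>)\<^sup>2" using L assms by (intro power_mono) auto
      then have "t\<^sup>2 * (\<delta>\<^sup>2 + 4 * p * q) \<le> (2 * p - t * \<delta>)\<^sup>2"
        using k by (simp add: power_mult_distrib algebra_simps)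
      then have "p * (t\<^sup>2 * q) \<le> p * (p - t * \<delta>)"
        by (simp add: power2_eq_square algebra_simps)
      then show ?thesis using False assms by simp
    qed
  next
    assume R: "t * \<delta> \<le> p - t\<^sup>2 * q"
    have "t\<^sup>2 * q \<ge> 0" using assms by simp
    then have pos: "2 * p - t * \<delta> \<ge> 0" using R assms by linarith
    have "p * (t\<^sup>2 * q) \<le> p * (p - t * \<delta>)" using R assms by (intro mult_left_mono) auto
    then have "t\<^sup>2 * (\<delta>\<^sup>2 + 4 * p * q) \<le> (2 * p - t * \<delta>)\<^sup>2"
      by (simp add: power2_eq_square algebra_simps)
    then have "(t * k)\<^sup>2 \<le> (2 * p - t * \<delta>)\<^sup>2"
      using k by (simp add: power_mult_distrib algebra_simps)
    then show "t * k \<le> 2 * p - t * \<delta>" using pos by (rule power2_le_imp_le)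
  qed
  finally show ?thesis .
qed

text \<open>In rank two the cross inequality decides, and it implies the diagonal ones. In rank one with
  \<open>(a, b) = \<rho> (c, d)\<close> the determinant vanishes and the diagonal inequalities decide, with threshold
  \<open>\<bar>\<rho>\<bar>\<close>. If the second row is zero, every \<open>t\<close> is admissible and \<open>phi\<close> is infinite.\<close>

lemma le_phi_iff_gap_form:
  fixes a b c d :: complex
  assumes t: "t \<ge> 0" and row1: "0 \<le> Re (a * cnj b)" and row2: "0 \<le> Re (c * cnj d)"
  shows "ennreal t \<le> phi (vector [vector [a, b], vector [c, d]]) \<longleftrightarrow>
    gap_form t a a c c \<and> gap_form t b b d d \<and> gap_form t a b c d"
proof -
  let ?M = "vector [vector [a, b], vector [c, d]] :: complex^2^2"
  have det: "det ?M = a * d - b * c" by (simp add: det_2)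
  have zero: "?M = 0 \<longleftrightarrow> a = 0 \<and> b = 0 \<and> c = 0 \<and> d = 0"
    by (auto simp: vec_eq_iff forall_2)
  consider (regular) "a * d - b * c \<noteq> 0"
    | (upper) "a * d - b * c = 0" "c = 0" "d = 0" "a \<noteq> 0 \<or> b \<noteq> 0"
    | (ratio) "a * d - b * c = 0" "c \<noteq> 0 \<or> d \<noteq> 0"
    | (zero) "a = 0" "b = 0" "c = 0" "d = 0" by blast
  then show ?thesis
  proof cases
    case regular
    let ?k = "cmod (a * cnj d + b * cnj c)" and ?\<delta> = "cmod (a * d - b * c)"
    have k: "?k\<^sup>2 - ?\<delta>\<^sup>2 = 4 * Re (a * cnj b) * Re (c * cnj d)"
      unfolding cmod_power2 by (simp add: power2_eq_square) algebra
    have "phi ?M = ennreal (2 * Re (a * cnj b) / (?k + ?\<delta>))"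
      using regular det by (simp add: phi_def Let_def rank_eq_2_iff_det)
    moreover have "2 * Re (a * cnj b) / (?k + ?\<delta>) \<ge> 0" using row1 by simp
    ultimately have "ennreal t \<le> phi ?M \<longleftrightarrow> t \<le> 2 * Re (a * cnj b) / (?k + ?\<delta>)"
      by (simp only: ennreal_le_iff)
    also have "\<dots> \<longleftrightarrow> gap_form t a b c d"
      unfolding gap_form_def using regular t row1 row2 k by (intro le_root_iff_gap) auto
    also have "\<dots> \<longleftrightarrow> gap_form t a a c c \<and> gap_form t b b d d \<and> gap_form t a b c d"
    proof -
      have "gap_form t a a c c \<and> gap_form t b b d d" if gap: "gap_form t a b c d"
      proof
        show "gap_form t a a c c" by (rule gap_form_imp_diag[OF t regular row2 gap])
        have "b * c - a * d \<noteq> 0" "0 \<le> Re (d * cnj c)" using regular row2 by (auto simp: algebra_simps)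
        then show "gap_form t b b d d"
          using gap_form_imp_diag[OF t _ _ gap[THEN gap_form_swap[THEN iffD1]]] by blast
      qed
      then show ?thesis by blast
    qed
    finally show ?thesis .
  next
    case upper
    have "rank ?M \<noteq> 2" "rank ?M = 1" unfolding rank_eq_2_iff_det rank_eq_1_iff_det det zero using upper by auto
    then have "phi ?M = \<infinity>"
      using upper by (auto simp: phi_def Let_def ennreal_divide_eq_top_iff)
    then show ?thesis using upper row1 by (simp add: gap_form_def)
  next
    case ratio
    then obtain \<rho> where \<rho>: "a = \<rho> * c" "b = \<rho> * d" by (rule dependent_rows_obtain_ratio)
    have "rank ?M \<noteq> 2" "rank ?M = 1" unfolding rank_eq_2_iff_det rank_eq_1_iff_det det zero using ratio by auto
    then have "phi ?M = ennreal (cmod \<rho>)"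
      using ratio(2) by (auto simp: phi_def Let_def \<rho> norm_mult divide_ennreal)
    then have "ennreal t \<le> phi ?M \<longleftrightarrow> t \<le> cmod \<rho>" by simp
    also have "\<dots> \<longleftrightarrow> gap_form t a a c c \<and> gap_form t b b d d \<and> gap_form t a b c d"
    proof
      assume le: "t \<le> cmod \<rho>"
      have "Re (a * cnj b) - t\<^sup>2 * Re (c * cnj d) = ((cmod \<rho>)\<^sup>2 - t\<^sup>2) * Re (c * cnj d)"
        unfolding \<rho> cmod_power2 by (simp add: power2_eq_square) algebra
      moreover have "t\<^sup>2 \<le> (cmod \<rho>)\<^sup>2" using le t by (intro power_mono)
      ultimately have "0 \<le> Re (a * cnj b) - t\<^sup>2 * Re (c * cnj d)"
        using row2 by (simp only: mult_nonneg_nonneg diff_ge_0_iff_ge)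
      then have "gap_form t a b c d" unfolding gap_form_def ratio(1) by simp
      then show "gap_form t a a c c \<and> gap_form t b b d d \<and> gap_form t a b c d"
        using le by (simp add: gap_form_diag[OF t]) (simp add: \<rho> norm_mult mult_right_mono)
    next
      assume "gap_form t a a c c \<and> gap_form t b b d d \<and> gap_form t a b c d"
      then show "t \<le> cmod \<rho>"
        using ratio(2) by (auto simp: gap_form_diag[OF t] \<rho> norm_mult)
    qed
    finally show ?thesis .
  next
    case zero': zero
    have "rank ?M \<noteq> 2" "rank ?M \<noteq> 1" unfolding rank_eq_2_iff_det rank_eq_1_iff_det det zero using zero' by auto
    then show ?thesis using zero' by (simp add: phi_def Let_def gap_form_def)
  qed
qed

section \<open>The order on the complexified cone\<close>

lemma complex_cone_ofD:
  "x \<in> complex_cone_of \<iota> K \<Longrightarrow> l1 \<in> dual_cone K \<Longrightarrow> l2 \<in> dual_cone K \<Longrightarrow>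
    0 \<le> Re (cpair \<iota> l1 x * cnj (cpair \<iota> l2 x))"
  unfolding complex_cone_of_def by blast

lemma gap_form_extend_functional:
  fixes \<iota> :: "'r::banach \<Rightarrow> 'a::complex_banach"
  assumes gM: "weak_star_generating \<iota> K M"
    and "\<And>m. m \<in> M \<Longrightarrow> gap_form t (cpair \<iota> m y) b (cpair \<iota> m z) d" and "t \<ge> 0" and "l \<in> dual_cone K"
  shows "gap_form t (cpair \<iota> l y) b (cpair \<iota> l z) d"
proof -
  define h where "h w = Re (fst w * cnj b) - t\<^sup>2 * Re (snd w * cnj d)" for w
  define g where "g w = of_real t * (fst w * d - b * snd w)" for w
  have "linear h" "linear g"
    unfolding h_def g_def by (auto intro!: linearI simp: algebra_simps)
  from weak_star_generating_extends_bound[OF gM this, of y z l] assms show ?thesis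
    by (simp add: gap_form_def h_def g_def norm_mult)
qed

lemma gap_form_on_dual_cone:
  fixes \<iota> :: "'r::banach \<Rightarrow> 'a::complex_banach"
  assumes gM: "weak_star_generating \<iota> K M"
    and "\<And>m1 m2. m1 \<in> M \<Longrightarrow> m2 \<in> M \<Longrightarrow>
      gap_form t (cpair \<iota> m1 y) (cpair \<iota> m2 y) (cpair \<iota> m1 z) (cpair \<iota> m2 z)"
    and "t \<ge> 0" and "l1 \<in> dual_cone K" "l2 \<in> dual_cone K"
  shows "gap_form t (cpair \<iota> l1 y) (cpair \<iota> l2 y) (cpair \<iota> l1 z) (cpair \<iota> l2 z)"
proof -
  have 1: "gap_form t (cpair \<iota> l1 y) (cpair \<iota> m y) (cpair \<iota> l1 z) (cpair \<iota> m z)" if "m \<in> M" for m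
    by (rule gap_form_extend_functional[OF gM]) (use assms that in simp_all)
  have "gap_form t (cpair \<iota> l2 y) (cpair \<iota> l1 y) (cpair \<iota> l2 z) (cpair \<iota> l1 z)"
    by (rule gap_form_extend_functional[OF gM 1[THEN gap_form_swap[THEN iffD1]]]) (use assms in simp_all)
  then show ?thesis by (rule gap_form_swap[THEN iffD1])
qed

text \<open>On \<open>K\<close> the two functionals are real and nonnegative, so all terms of the expanded product have
  nonnegative real part.\<close>

lemma combination_in_complex_dual_cone:
  fixes \<iota> :: "'r::banach \<Rightarrow> 'a::complex_banach"
  assumes cx: "complexification \<iota>"
    and l: "l1 \<in> dual_cone K" "l2 \<in> dual_cone K" and sr: "0 \<le> Re (s * cnj r)"
  shows "(\<lambda>x. s * cpair \<iota> l1 x + r * cpair \<iota> l2 x) \<in> complex_dual_cone_of \<iota> K"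
  unfolding complex_dual_cone_of_def
proof (intro CollectI conjI ballI)
  have "bounded_linear (\<lambda>x. s * cpair \<iota> l1 x + r * cpair \<iota> l2 x)"
    by (intro bounded_linear_add bounded_linear_compose[OF bounded_linear_mult_right]
        bounded_clinear_imp_bounded_linear cpair_bounded_clinear[OF cx])
  then show "bounded_clinear (\<lambda>x. s * cpair \<iota> l1 x + r * cpair \<iota> l2 x)"
    by (simp add: bounded_clinear_def scaleC_complex_def cpair_scaleC[OF cx] algebra_simps)
  fix u v assume uv: "u \<in> K" "v \<in> K"
  define p q p' q' where "p = blinfun_apply l1 u" and "q = blinfun_apply l2 u"
    and "p' = blinfun_apply l1 v" and "q' = blinfun_apply l2 v"
  have nn: "0 \<le> p" "0 \<le> q" "0 \<le> p'" "0 \<le> q'"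
    using l uv by (auto simp: dual_cone_def p_def q_def p'_def q'_def)
  have "Re ((s * of_real p + r * of_real q) * cnj (s * of_real p' + r * of_real q')) =
      (cmod s)\<^sup>2 * (p * p') + (cmod r)\<^sup>2 * (q * q') + Re (s * cnj r) * (p * q' + q * p')"
    unfolding cmod_power2 by (simp add: power2_eq_square algebra_simps)
  also have "\<dots> \<ge> 0" using nn sr by (intro add_nonneg_nonneg mult_nonneg_nonneg) auto
  finally show "0 \<le> Re ((s * cpair \<iota> l1 (\<iota> u) + r * cpair \<iota> l2 (\<iota> u)) *
      cnj (s * cpair \<iota> l1 (\<iota> v) + r * cpair \<iota> l2 (\<iota> v)))"
    by (simp only: cpair_embed[OF cx] p_def q_def p'_def q'_def)
qed

lemma cpair_in_complex_dual_cone: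
  "complexification \<iota> \<Longrightarrow> l \<in> dual_cone K \<Longrightarrow> cpair \<iota> l \<in> complex_dual_cone_of \<iota> K"
  using combination_in_complex_dual_cone[of \<iota> l K l 1 0] by simp

lemma weak_star_generating_in_dual_cone:
  "weak_star_generating \<iota> K M \<Longrightarrow> m \<in> M \<Longrightarrow> m \<in> dual_cone K"
  by (auto simp: weak_star_generating_def)

text \<open>Domination is tested on \<open>s m1 + r m2\<close> in one direction. In the other, the inequality extends from
  \<open>M\<close> to pairs in the dual cone, and every \<open>\<mu>\<close> is a unimodular multiple of some \<open>l1 + i l2\<close>.\<close>

theorem dominates_iff_gap_form:
  fixes \<iota> :: "'r::banach \<Rightarrow> 'a::complex_banach"
  assumes cx: "complexification \<iota>" and gM: "weak_star_generating \<iota> K M"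
    and y: "y \<in> complex_cone_of \<iota> K" and z: "z \<in> complex_cone_of \<iota> K" and t: "t \<ge> 0"
  shows "dominates \<iota> K y (t *\<^sub>R z) \<longleftrightarrow> (\<forall>m1\<in>M. \<forall>m2\<in>M.
    gap_form t (cpair \<iota> m1 y) (cpair \<iota> m2 y) (cpair \<iota> m1 z) (cpair \<iota> m2 z))" (is "_ \<longleftrightarrow> ?R")
proof -
  have scale: "cmod (\<mu> (t *\<^sub>R z)) = t * cmod (\<mu> z)" if "\<mu> \<in> complex_dual_cone_of \<iota> K" for \<mu>
    using bounded_clinear_scaleR[of \<mu> t z] that t by (simp add: complex_dual_cone_of_def)
  show ?thesis
  proof
    assume dom: "dominates \<iota> K y (t *\<^sub>R z)"
    show ?R
    proof (intro ballI)
      fix m1 m2 assume "m1 \<in> M" "m2 \<in> M"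
      then have m: "m1 \<in> dual_cone K" "m2 \<in> dual_cone K" by (simp_all add: weak_star_generating_in_dual_cone[OF gM])
      show "gap_form t (cpair \<iota> m1 y) (cpair \<iota> m2 y) (cpair \<iota> m1 z) (cpair \<iota> m2 z)"
      proof (rule dominated_imp_gap_form[OF t])
        show "0 \<le> Re (cpair \<iota> m1 y * cnj (cpair \<iota> m2 y))" "0 \<le> Re (cpair \<iota> m1 z * cnj (cpair \<iota> m2 z))"
          by (rule complex_cone_ofD[OF y m], rule complex_cone_ofD[OF z m])
        fix s r :: complex assume "0 \<le> Re (s * cnj r)"
        note \<mu> = combination_in_complex_dual_cone[OF cx m this]
        show "t * cmod (s * cpair \<iota> m1 z + r * cpair \<iota> m2 z) \<le> cmod (s * cpair \<iota> m1 y + r * cpair \<iota> m2 y)"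
          using dom[unfolded dominates_def, rule_format, OF \<mu>] scale[OF \<mu>] by simp
      qed
    qed
  next
    assume R: ?R
    show "dominates \<iota> K y (t *\<^sub>R z)"
      unfolding dominates_def
    proof
      fix \<mu> assume \<mu>: "\<mu> \<in> complex_dual_cone_of \<iota> K"
      obtain c l1 l2 where c: "cmod c = 1" and l: "l1 \<in> dual_cone K" "l2 \<in> dual_cone K"
        and \<mu>': "\<And>x. \<mu> x = c * (cpair \<iota> l1 x + \<i> * cpair \<iota> l2 x)"
        using complex_dual_cone_decomp[OF cx \<mu>] by metis
      have gap: "gap_form t (cpair \<iota> k y) (cpair \<iota> l y) (cpair \<iota> k z) (cpair \<iota> l z)"
        if "k \<in> dual_cone K" "l \<in> dual_cone K" for k l
        by (rule gap_form_on_dual_cone[OF gM]) (use R t that in blast)+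
      have "t * cmod (cpair \<iota> l1 z + \<i> * cpair \<iota> l2 z) \<le> cmod (cpair \<iota> l1 y + \<i> * cpair \<iota> l2 y)"
        by (rule gap_form_imp_dominated[OF t]) (use gap l in blast)+
      then show "cmod (\<mu> (t *\<^sub>R z)) \<le> cmod (\<mu> y)"
        unfolding scale[OF \<mu>] by (simp only: \<mu>' norm_mult c mult_1_left)
    qed
  qed
qed

lemma SUP_ennreal_below: "(SUP t\<in>{t. 0 \<le> t \<and> ennreal t \<le> I}. ennreal t) = I"
proof (rule antisym)
  show "(SUP t\<in>{t. 0 \<le> t \<and> ennreal t \<le> I}. ennreal t) \<le> I" by (rule SUP_least) simp
  show "I \<le> (SUP t\<in>{t. 0 \<le> t \<and> ennreal t \<le> I}. ennreal t)"
  proof (rule dense_le)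
    fix s assume "s < I"
    then obtain r where "s = ennreal r" "r \<ge> 0" by (cases s) auto
    with \<open>s < I\<close> show "s \<le> (SUP t\<in>{t. 0 \<le> t \<and> ennreal t \<le> I}. ennreal t)"
      by (auto intro!: SUP_upper2[of r])
  qed
qed

text \<open>Both sides are determined by the \<open>t\<close> below them, and by the preceding equivalences these are the same
  \<open>t\<close>.\<close>

theorem alpha_eq_INF_phi:
  fixes \<iota> :: "'r::banach \<Rightarrow> 'a::complex_banach"
  assumes cx: "complexification \<iota>" and gM: "weak_star_generating \<iota> K M"
    and y: "y \<in> complex_cone_of \<iota> K" and z: "z \<in> complex_cone_of \<iota> K"
  shows "alpha \<iota> K y z = (INF m1\<in>M. INF m2\<in>M. phi (pairing_matrix \<iota> m1 m2 y z))" (is "_ = ?I")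
proof -
  have "dominates \<iota> K y (t *\<^sub>R z) \<longleftrightarrow> ennreal t \<le> ?I" if t: "t \<ge> 0" for t
  proof -
    let ?G = "\<lambda>m1 m2. gap_form t (cpair \<iota> m1 y) (cpair \<iota> m2 y) (cpair \<iota> m1 z) (cpair \<iota> m2 z)"
    have "ennreal t \<le> phi (pairing_matrix \<iota> m1 m2 y z) \<longleftrightarrow> ?G m1 m1 \<and> ?G m2 m2 \<and> ?G m1 m2"
      if "m1 \<in> M" "m2 \<in> M" for m1 m2
      unfolding pairing_matrix_def
    proof (rule le_phi_iff_gap_form[OF t])
      show "0 \<le> Re (cpair \<iota> m1 y * cnj (cpair \<iota> m2 y))" "0 \<le> Re (cpair \<iota> m1 z * cnj (cpair \<iota> m2 z))"
        using complex_cone_ofD[OF y] complex_cone_ofD[OF z] weak_star_generating_in_dual_cone[OF gM] that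
        by blast+
    qed
    then show ?thesis
      unfolding dominates_iff_gap_form[OF cx gM y z t] le_INF_iff by blast
  qed
  then have "{t. 0 \<le> t \<and> dominates \<iota> K y (t *\<^sub>R z)} = {t. 0 \<le> t \<and> ennreal t \<le> ?I}" by blast
  then show ?thesis unfolding alpha_def by (simp only: SUP_ennreal_below)
qed

theorem theorem4p2:
  fixes \<iota> :: "'r::banach \<Rightarrow> 'a::complex_banach"
    and K E :: "'r set"
    and M :: "('r \<Rightarrow>\<^sub>L real) set"
    and A :: "'a \<Rightarrow> 'a"
  assumes "complexification \<iota>"
    and "real_cone K"
    and "generating K E"
    and "weak_star_generating \<iota> K M"
    and "bounded_clinear A"
    and "test_matrices \<iota> E M A \<subseteq> Gamma_bar"
  shows "spectral_radius A \<ge> (SUP x\<in>complex_cone_of \<iota> K - {0}. alpha \<iota> K (A x) x) \<and>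
    (SUP x\<in>complex_cone_of \<iota> K - {0}. alpha \<iota> K (A x) x) =
    (SUP x\<in>complex_cone_of \<iota> K - {0}. INF m1\<in>M. INF m2\<in>M. phi (pairing_matrix \<iota> m1 m2 (A x) x))"
proof
  note invariant = complex_cone_invariant[OF assms] complex_dual_cone_invariant[OF assms(1,3-6)]
  show "(SUP x\<in>complex_cone_of \<iota> K - {0}. alpha \<iota> K (A x) x) \<le> spectral_radius A"
  proof (rule SUP_least)
    fix x assume x: "x \<in> complex_cone_of \<iota> K - {0}"
    show "alpha \<iota> K (A x) x \<le> spectral_radius A"
      unfolding alpha_def
    proof (rule SUP_least)
      fix t assume t: "t \<in> {t. 0 \<le> t \<and> dominates \<iota> K (A x) (t *\<^sub>R x)}"
      show "ennreal t \<le> spectral_radius A"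
      proof (cases "t = 0")
        case False
        obtain l where l: "l \<in> dual_cone K" "cpair \<iota> l x \<noteq> 0"
          using complex_cone_separated[OF assms(1,2)] x by blast
        \<comment> \<open>Transporting \<open>l\<close> along the orbit stays in the complexified dual cone, where domination can be applied.\<close>
        have orbit: "(\<lambda>x. cpair \<iota> l ((A ^^ n) x)) \<in> complex_dual_cone_of \<iota> K" for n
        proof (induction n)
          case 0
          then show ?case using cpair_in_complex_dual_cone[OF assms(1) l(1)] by simp
        next
          case (Suc n)
          then show ?case using invariant(2)[OF Suc] by (simp add: funpow_swap1)
        qed
        have "cmod (cpair \<iota> l x) * t ^ n \<le> cmod (cpair \<iota> l ((A ^^ n) x))" for n
        proof (induction n)
          case (Suc n)
          have bc: "bounded_clinear (\<lambda>x. cpair \<iota> l ((A ^^ n) x))"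
            using orbit[of n] by (simp add: complex_dual_cone_of_def)
          have "cmod (cpair \<iota> l x) * t ^ Suc n \<le> t * cmod (cpair \<iota> l ((A ^^ n) x))"
            using mult_left_mono[OF Suc, of t] t by (simp add: mult_ac)
          also have "\<dots> = cmod (cpair \<iota> l ((A ^^ n) (t *\<^sub>R x)))"
            using bounded_clinear_scaleR[OF bc, of t x] t by simp
          also have "\<dots> \<le> cmod (cpair \<iota> l ((A ^^ n) (A x)))"
            using t orbit[of n] by (auto simp: dominates_def)
          finally show ?case by (simp add: funpow_swap1)
        qed simp
        then show ?thesis
          using t False l(2) cpair_bounded_clinear[OF assms(1)]
          by (intro spectral_radius_ge_orbit_growth[OF assms(5)]) auto
      qed simp
    qed
  qed
  show "(SUP x\<in>complex_cone_of \<iota> K - {0}. alpha \<iota> K (A x) x) =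
    (SUP x\<in>complex_cone_of \<iota> K - {0}. INF m1\<in>M. INF m2\<in>M. phi (pairing_matrix \<iota> m1 m2 (A x) x))"
    using invariant(1) by (intro SUP_cong refl alpha_eq_INF_phi[OF assms(1,4)]) auto
qed

end
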